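(* Assume that $(f,f';h)$ satisfies the basic assumptions with parameters $(M_f,M_h,\mu)\in\mathbb{R}_+\times[0,\infty]\times\mathbb{R}_+$. Let $x_0\in\operatorname{dom}h$, $\lambda>0$, $\bar\varepsilon>0$ be given, and put $M=M_f+M_h$, $\tilde\lambda=\lambda/(1+\lambda\mu)$. Then the following statements hold for RPB$(x_0,\lambda,\delta)$ with $\delta=\bar\varepsilon/2$: (a) the number of serious iterations performed until it obtains $\hat z_k$ such that $\phi(\hat z_k)-\phi^*\le\bar\varepsilon$ is bounded by $$\min\left\{\frac{d_0^2}{\lambda\bar\varepsilon},\ \frac{1}{\tilde\lambda\mu}\log\left(\frac{\mu d_0^2}{\bar\varepsilon}+1\right)\right\}+1;$$ (b) if $\ell_0$ denotes an arbitrary serious iteration index and all the iterates $\hat z_k$ generated up to and including the $\ell_0$-th iteration satisfy $\phi(\hat z_k)-\phi^*>\bar\varepsilon$, then the next serious iteration index $\ell_1>\ell_0$ occurs and satisfies $$\ell_1-\ell_0\le\frac{\min\left\{2(16)^{4/3}\lambda MM_f,\ 2(16)^{4/3}\tilde\lambda M_f^2+40\sqrt2\,M_fd_0\right\}}{\bar\varepsilon}+1;$$ (c) the total number of iterations (serious and null) performed until it obtains $\hat z_k$ such that $\phi(\hat z_k)-\phi^*\le\bar\varepsilon$ is bounded by $$\left(\frac{2(16)^{4/3}M_f\min\{\lambda M,\ \tilde\lambda M_f+d_0\}}{\bar\varepsilon}+1\right)\left[\min\left\{\frac{d_0^2}{\lambda\bar\varepsilon},\ \frac{1}{\tilde\lambda\mu}\log\left(\frac{\mu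 d_0^2}{\bar\varepsilon}+1\right)\right\}+1\right].$$
   Context: Problem: $\phi^*:=\min\{\phi(x):=f(x)+h(x):x\in\mathbb{R}^n\}$. We say $(f,f';h)$ satisfies the basic assumptions with parameters $(M_f,M_h,\mu)$ if: (i) $f,h:\mathbb{R}^n\to(-\infty,+\infty]$ are proper lower semicontinuous convex, $\operatorname{dom}h\subset\operatorname{dom}f$, and $f':\operatorname{dom}h\to\mathbb{R}^n$ satisfies $f'(x)\in\partial f(x)$ for all $x\in\operatorname{dom}h$; (ii) the set $X^*$ of minimizers of $\phi$ is nonempty; (iii) $h$ is $\mu$-convex, i.e. $h(\alpha z+(1-\alpha)u)\le\alpha h(z)+(1-\alpha)h(u)-\frac{\alpha(1-\alpha)\mu}{2}\|z-u\|^2$ for all $z,u\in\operatorname{dom}h$, $\alpha\in[0,1]$, and $\|f'(x)\|\le M_f$ for all $x\in\operatorname{dom}h$; (iv) $|h(u)-h(v)|\le M_h\|u-v\|$ for all $u,v\in\operatorname{dom}h$ ($M_h=\infty$ is allowed, imposing no condition). Here $\|\cdot\|$ is the Euclidean norm. $d_0:=\inf\{\|x_0-x^*\|:x^*\in X^*\}$. Method RPB$(x_0,\lambda,\delta)$ ($x_0\in\operatorname{dom}h$, $\lambda>0$, $\delta>0$). Set $x_0^c=\tilde x_0=\hat z_0=x_0$, $C_1=\{x_0\}$, $k=1$. For $j=1,2,\dots$: let $f_j(u)=\max\{f(x)+\langle f'(x),u-x\rangle:x\in C_j\}$; let $x_j$ be the unique minimizer and $m_j$ the minimum value over $u\in\mathbb{R}^n$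 of $f_j(u)+h(u)+\frac1{2\lambda}\|u-x_{j-1}^c\|^2$; let $\phi_j^\lambda:=\phi+\frac1{2\lambda}\|\cdot-x_{j-1}^c\|^2$; choose $\tilde x_j\in\operatorname{Argmin}\{\phi_j^\lambda(u):u\in\{x_j,\tilde x_{j-1}\}\}$; let $t_j:=\phi_j^\lambda(\tilde x_j)-m_j$. If $t_j\le\delta$ (iteration $j$ is serious): choose any finite $C_{j+1}$ with $\{x_j\}\subset C_{j+1}\subset\{x_0,\dots,x_j\}$, set $x_j^c=x_j$, choose $\hat z_k\in\operatorname{Argmin}\{\phi(u):u\in\{\hat z_{k-1},\tilde x_j\}\}$, and increase $k$ by 1. Otherwise (iteration $j$ is null): set $x_j^c=x_{j-1}^c$ and choose any $C_{j+1}$ with $A_j\cup\{x_j\}\subset C_{j+1}\subset C_j\cup\{x_j\}$, where $A_j:=\{x\in C_j:f(x)+\langle f'(x),x_j-x\rangle=f_j(x_j)\}$. By convention $j=0$ is also called a serious iteration index (but it is not a performed iteration). The statements hold for all admissible choices. Convention: when $\mu=0$, the term $\frac{1}{\tilde\lambda\mu}\log(\frac{\mu d_0^2}{\bar\varepsilon}+1)$ is understood as $d_0^2/(\lambda\bar\varepsilon)$. *)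

theory Defs
  imports "HOL-Analysis.Analysis"
begin

section \<open>Extended-real-valued convex functions\<close>

definition edom :: "('a \<Rightarrow> ereal) \<Rightarrow> 'a set" where
  "edom f = {x. f x < \<infinity>}"

definition proper :: "('a \<Rightarrow> ereal) \<Rightarrow> bool" where
  "proper f \<longleftrightarrow> (\<forall>x. f x \<noteq> -\<infinity>) \<and> edom f \<noteq> {}"

definition lsc :: "('a::topological_space \<Rightarrow> ereal) \<Rightarrow> bool" where
  "lsc f \<longleftrightarrow> (\<forall>x. f x \<le> Liminf (at x) f)"

text \<open>The products below use \<open>0 * \<infinity> = 0\<close>, so the end points of \<open>[0, 1]\<close> impose no condition.\<close>

definition convex_fun :: "('a::real_vector \<Rightarrow> ereal) \<Rightarrow> bool" where
  "convex_fun f \<longleftrightarrow>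
     (\<forall>x y. \<forall>\<alpha>\<in>{0..1::real}.
        f (\<alpha> *\<^sub>R x + (1 - \<alpha>) *\<^sub>R y) \<le> ereal \<alpha> * f x + ereal (1 - \<alpha>) * f y)"

definition mu_convex :: "real \<Rightarrow> ('a::real_normed_vector \<Rightarrow> ereal) \<Rightarrow> bool" where
  "mu_convex \<mu> h \<longleftrightarrow>
     (\<forall>z\<in>edom h. \<forall>u\<in>edom h. \<forall>\<alpha>\<in>{0..1::real}.
        h (\<alpha> *\<^sub>R z + (1 - \<alpha>) *\<^sub>R u)
          \<le> ereal \<alpha> * h z + ereal (1 - \<alpha>) * h u
             - ereal (\<alpha> * (1 - \<alpha>) * \<mu> / 2 * (norm (z - u))\<^sup>2))"

definition subdifferential :: "('a::real_inner \<Rightarrow> ereal) \<Rightarrow> 'a \<Rightarrow> 'a set" where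
  "subdifferential f x = {g. \<forall>y. f x + ereal (g \<bullet> (y - x)) \<le> f y}"


section \<open>The problem class\<close>

definition objective :: "('a \<Rightarrow> ereal) \<Rightarrow> ('a \<Rightarrow> ereal) \<Rightarrow> 'a \<Rightarrow> ereal" where
  "objective f h x = f x + h x"

definition solutions :: "('a \<Rightarrow> ereal) \<Rightarrow> ('a \<Rightarrow> ereal) \<Rightarrow> 'a set" where
  "solutions f h = {x. is_arg_min (objective f h) (\<lambda>_. True) x}"

definition opt_value :: "('a \<Rightarrow> ereal) \<Rightarrow> ('a \<Rightarrow> ereal) \<Rightarrow> ereal" where
  "opt_value f h = (INF x. objective f h x)"

definition dist_solutions ::
    "('a::real_normed_vector \<Rightarrow> ereal) \<Rightarrow> ('a \<Rightarrow> ereal) \<Rightarrow> 'a \<Rightarrow> real" where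
  "dist_solutions f h x\<^sub>0 = (INF x\<in>solutions f h. norm (x\<^sub>0 - x))"

text \<open>In the last condition, \<open>M\<^sub>h = \<infinity>\<close> imposes nothing: the right-hand side is \<open>\<infinity>\<close> for
  \<open>u \<noteq> v\<close>, and both sides are \<open>0\<close> for \<open>u = v\<close>. The function \<open>f'\<close> is only relevant on \<open>edom h\<close>.\<close>

definition basic_assumptions ::
    "('a::euclidean_space \<Rightarrow> ereal) \<Rightarrow> ('a \<Rightarrow> 'a) \<Rightarrow> ('a \<Rightarrow> ereal) \<Rightarrow> real \<Rightarrow> ereal \<Rightarrow> real \<Rightarrow> bool"
  where
  "basic_assumptions f f' h M\<^sub>f M\<^sub>h \<mu> \<longleftrightarrow>
     proper f \<and> lsc f \<and> convex_fun f \<and>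
     proper h \<and> lsc h \<and> convex_fun h \<and>
     edom h \<subseteq> edom f \<and> (\<forall>x\<in>edom h. f' x \<in> subdifferential f x) \<and>
     solutions f h \<noteq> {} \<and>
     mu_convex \<mu> h \<and> (\<forall>x\<in>edom h. norm (f' x) \<le> M\<^sub>f) \<and>
     (\<forall>u\<in>edom h. \<forall>v\<in>edom h. \<bar>h u - h v\<bar> \<le> M\<^sub>h * ereal (norm (u - v)))"


section \<open>The method RPB\<close>

text \<open>A run of the method is recorded by the sequences \<open>x\<^sub>j\<close>, \<open>x\<^sub>j\<^sup>c\<close>, the auxiliary points
  x-tilde (\<open>aux_pt\<close>), the bundles \<open>C\<^sub>j\<close>, the value of the counter \<open>k\<close> at the end of iteration \<open>j\<close>
  (initially, i.e. for \<open>j = 0\<close>, it is \<open>1\<close>), and the points z-hat (\<open>zhat\<close>), which are indexed by the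
  counter \<open>k\<close> and not by the iteration. The points z-hat generated up to and including iteration
  \<open>j\<close> are thus those with index \<open>k < counter r j\<close>.\<close>

record 'a rpb_run =
  iter    :: "nat \<Rightarrow> 'a"
  center  :: "nat \<Rightarrow> 'a"
  aux_pt  :: "nat \<Rightarrow> 'a"
  cuts    :: "nat \<Rightarrow> 'a set"
  counter :: "nat \<Rightarrow> nat"
  zhat    :: "nat \<Rightarrow> 'a"

definition linearization ::
    "('a::real_inner \<Rightarrow> ereal) \<Rightarrow> ('a \<Rightarrow> 'a) \<Rightarrow> 'a \<Rightarrow> 'a \<Rightarrow> ereal" where
  "linearization f f' x u = f x + ereal (f' x \<bullet> (u - x))"

definition cutting_plane ::
    "('a::real_inner \<Rightarrow> ereal) \<Rightarrow> ('a \<Rightarrow> 'a) \<Rightarrow> 'a set \<Rightarrow> 'a \<Rightarrow> ereal" where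
  "cutting_plane f f' C u = Max ((\<lambda>x. linearization f f' x u) ` C)"

definition prox_term :: "real \<Rightarrow> 'a::real_normed_vector \<Rightarrow> 'a \<Rightarrow> ereal" where
  "prox_term lam c u = ereal (1 / (2 * lam) * (norm (u - c))\<^sup>2)"

definition prox_objective ::
    "('a::real_normed_vector \<Rightarrow> ereal) \<Rightarrow> ('a \<Rightarrow> ereal) \<Rightarrow> real \<Rightarrow> 'a \<Rightarrow> 'a \<Rightarrow> ereal" where
  "prox_objective f h lam c u = objective f h u + prox_term lam c u"

definition prox_model ::
    "('a::real_inner \<Rightarrow> ereal) \<Rightarrow> ('a \<Rightarrow> 'a) \<Rightarrow> ('a \<Rightarrow> ereal) \<Rightarrow> real \<Rightarrow> 'a set \<Rightarrow> 'a \<Rightarrow> 'a \<Rightarrow> ereal"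
  where
  "prox_model f f' h lam C c u = cutting_plane f f' C u + h u + prox_term lam c u"

definition gap ::
    "('a::real_inner \<Rightarrow> ereal) \<Rightarrow> ('a \<Rightarrow> 'a) \<Rightarrow> ('a \<Rightarrow> ereal) \<Rightarrow> real \<Rightarrow> 'a rpb_run \<Rightarrow> nat \<Rightarrow> ereal"
  where
  "gap f f' h lam r j =
     prox_objective f h lam (center r (j - 1)) (aux_pt r j)
       - (INF u. prox_model f f' h lam (cuts r j) (center r (j - 1)) u)"

text \<open>Serious iteration indices; \<open>j = 0\<close> is one by convention although no iteration \<open>0\<close> is performed.\<close>

definition serious ::
    "('a::real_inner \<Rightarrow> ereal) \<Rightarrow> ('a \<Rightarrow> 'a) \<Rightarrow> ('a \<Rightarrow> ereal) \<Rightarrow> real \<Rightarrow> real \<Rightarrow> 'a rpb_run \<Rightarrow> nat \<Rightarrow> bool"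
  where
  "serious f f' h lam \<delta> r j \<longleftrightarrow> j = 0 \<or> gap f f' h lam r j \<le> ereal \<delta>"

definition active ::
    "('a::real_inner \<Rightarrow> ereal) \<Rightarrow> ('a \<Rightarrow> 'a) \<Rightarrow> 'a rpb_run \<Rightarrow> nat \<Rightarrow> 'a set" where
  "active f f' r j =
     {x \<in> cuts r j.
        linearization f f' x (iter r j) = cutting_plane f f' (cuts r j) (iter r j)}"

text \<open>\<open>rpb f f' h x\<^sub>0 lam \<delta> r\<close> holds if \<open>r\<close> results from some sequence of admissible choices. The
  method has no stopping test, so a run is infinite. The minimizer \<open>iter r j\<close> of the proximal
  subproblem exists and is unique because the model is proper, lower semicontinuous and strongly
  convex.\<close>

definition rpb ::
    "('a::euclidean_space \<Rightarrow> ereal) \<Rightarrow> ('a \<Rightarrow> 'a) \<Rightarrow> ('a \<Rightarrow> ereal) \<Rightarrow> 'a \<Rightarrow> real \<Rightarrow> real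
      \<Rightarrow> 'a rpb_run \<Rightarrow> bool"
  where
  "rpb f f' h x\<^sub>0 lam \<delta> r \<longleftrightarrow>
     iter r 0 = x\<^sub>0 \<and> center r 0 = x\<^sub>0 \<and> aux_pt r 0 = x\<^sub>0 \<and> zhat r 0 = x\<^sub>0 \<and>
     cuts r 1 = {x\<^sub>0} \<and> counter r 0 = 1 \<and>
     (\<forall>j\<ge>1.
        is_arg_min (prox_model f f' h lam (cuts r j) (center r (j - 1))) (\<lambda>_. True) (iter r j) \<and>
        is_arg_min (prox_objective f h lam (center r (j - 1)))
          (\<lambda>u. u \<in> {iter r j, aux_pt r (j - 1)}) (aux_pt r j) \<and>
        (if serious f f' h lam \<delta> r j
         then {iter r j} \<subseteq> cuts r (j + 1) \<and> cuts r (j + 1) \<subseteq> iter r ` {0..j} \<and>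
              center r j = iter r j \<and>
              is_arg_min (objective f h)
                (\<lambda>u. u \<in> {zhat r (counter r (j - 1) - 1), aux_pt r j}) (zhat r (counter r (j - 1))) \<and>
              counter r j = counter r (j - 1) + 1
         else center r j = center r (j - 1) \<and>
              active f f' r j \<union> {iter r j} \<subseteq> cuts r (j + 1) \<and>
              cuts r (j + 1) \<subseteq> cuts r j \<union> {iter r j} \<and>
              counter r j = counter r (j - 1)))"

definition eps_solution :: "('a \<Rightarrow> ereal) \<Rightarrow> ('a \<Rightarrow> ereal) \<Rightarrow> real \<Rightarrow> 'a \<Rightarrow> bool" where
  "eps_solution f h \<epsilon> z \<longleftrightarrow> objective f h z - opt_value f h \<le> ereal \<epsilon>"

text \<open>The first such \<open>z\<close>-hat may be \<open>x\<^sub>0\<close> itself, in which case \<open>N = 0\<close> iterations are performed.\<close>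

definition performed_until_solved ::
    "('a \<Rightarrow> ereal) \<Rightarrow> ('a \<Rightarrow> ereal) \<Rightarrow> real \<Rightarrow> 'a rpb_run \<Rightarrow> nat \<Rightarrow> bool" where
  "performed_until_solved f h \<epsilon> r N \<longleftrightarrow>
     (\<exists>k<counter r N. eps_solution f h \<epsilon> (zhat r k)) \<and>
     (\<forall>j<N. \<forall>k<counter r j. \<not> eps_solution f h \<epsilon> (zhat r k))"


section \<open>Complexity bound\<close>

text \<open>For \<open>\<mu> = 0\<close> the logarithmic term is read as its limit \<open>d\<^sub>0\<^sup>2 / (\<lambda> \<epsilon>)\<close>.\<close>

definition log_term :: "real \<Rightarrow> real \<Rightarrow> real \<Rightarrow> real \<Rightarrow> real" where
  "log_term lam \<mu> d\<^sub>0 \<epsilon> =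
     (if \<mu> = 0 then d\<^sub>0\<^sup>2 / (lam * \<epsilon>)
      else 1 / (lam / (1 + lam * \<mu>) * \<mu>) * ln (\<mu> * d\<^sub>0\<^sup>2 / \<epsilon> + 1))"

end

theory Submission
  imports Defs
begin

text \<open>Throughout, \<open>t\<^sub>j\<close> is the gap between the best proximal objective value known at iteration \<open>j\<close> and
  the minimum of the proximal model, and \<open>\<lambda>' = \<lambda> / (1 + \<lambda> \<mu>)\<close>, so that proximal models and proximal
  objectives are strongly convex with modulus \<open>1 / \<lambda>'\<close>.

  Serious iterations. The new center is the minimizer of a strongly convex lower model of the
  proximal objective. Comparing the minimum of the model with its value at a solution \<open>s\<close>, and using
  that the gap is at most half the accuracy \<open>\<epsilon>\<close>, a serious iteration that does not find an
  \<open>\<epsilon>\<close>-solution takes the squared distance \<open>a\<close> of the center to \<open>s\<close> to some \<open>a'\<close> with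
  \<open>(1 + \<lambda> \<mu>) a' + \<lambda> \<epsilon> \<le> a\<close> (\<open>serious_descent\<close>). Unrolled, this is a geometric sum (\<open>energy\<close>), and both
  bounds on the number of serious iterations are ways of reading it off (\<open>serious_count_le\<close>).

  Null iterations. The cuts that are active at \<open>x\<^sub>j\<close> are kept, and they alone already force the model
  to grow quadratically away from \<open>x\<^sub>j\<close> (\<open>model_growth\<close>); so the minimum of the model increases by at
  least \<open>\<parallel>x\<^sub>j\<^sub>+\<^sub>1 - x\<^sub>j\<parallel>\<^sup>2 / (2 \<lambda>')\<close>. The cut at \<open>x\<^sub>j\<close> is kept as well, and therefore
  \<open>t\<^sub>j\<^sub>+\<^sub>1 \<le> 2 M\<^sub>f \<parallel>x\<^sub>j\<^sub>+\<^sub>1 - x\<^sub>j\<parallel>\<close>. Together, \<open>t\<^sub>j\<^sub>+\<^sub>1\<^sup>2 \<le> A (t\<^sub>j - t\<^sub>j\<^sub>+\<^sub>1)\<close> with \<open>A = 8 \<lambda>' M\<^sub>f\<^sup>2\<close>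
  (\<open>null_step_gap\<close>), and a sequence that satisfies this can stay above \<open>\<delta>\<close> for at most
  \<open>(A + t\<^sub>1) / \<delta>\<close> terms, \<open>t\<^sub>1\<close> being its first one (\<open>sublinear_decrease_length\<close>). That first gap is
  controlled by the length of the first step away from the center, which is at most \<open>\<lambda> (M\<^sub>f + M\<^sub>h)\<close>
  when \<open>h\<close> is Lipschitz, and at most \<open>4 \<lambda>' M\<^sub>f + 2 \<parallel>c - s\<parallel>\<close> for the center \<open>c\<close> in general
  (\<open>step_length_Lipschitz\<close>, \<open>step_length_minimizer\<close>); by the descent of the centers
  \<open>\<parallel>c - s\<parallel> \<le> \<parallel>x\<^sub>0 - s\<parallel>\<close>. This gives the bound on the length of a cycle with the constant 32
  (\<open>null_run_length_uniform\<close>), which is smaller than \<open>2 (16)\<^sup>4\<^sup>/\<^sup>3\<close> and than \<open>40 \<surd>2\<close>. The total number of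
  iterations is at most the number of cycles times the length of the longest one.\<close>

section \<open>Proximal cutting-plane models\<close>

text \<open>The whole argument takes place on the domain \<open>D\<close> of \<open>h\<close>, where all functions are
  finite; it is therefore carried out for real-valued functions whose values matter only on \<open>D\<close>.\<close>

locale composite_convex =
  fixes D :: "'a::real_inner set" and F H :: "'a \<Rightarrow> real" and g :: "'a \<Rightarrow> 'a"
    and Mf \<mu> lam :: real
  assumes lam_pos: "lam > 0" and mu_nonneg: "\<mu> \<ge> 0"
    and convex_dom: "\<lbrakk>x \<in> D; y \<in> D; 0 \<le> \<alpha>; \<alpha> \<le> 1\<rbrakk> \<Longrightarrow> \<alpha> *\<^sub>R x + (1 - \<alpha>) *\<^sub>R y \<in> D"
    and subgradient: "\<lbrakk>x \<in> D; y \<in> D\<rbrakk> \<Longrightarrow> F x + g x \<bullet> (y - x) \<le> F y"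
    and subgradient_bound: "x \<in> D \<Longrightarrow> norm (g x) \<le> Mf"
    and strongly_convex: "\<lbrakk>x \<in> D; y \<in> D; 0 \<le> \<alpha>; \<alpha> \<le> 1\<rbrakk> \<Longrightarrow>
      H (\<alpha> *\<^sub>R x + (1 - \<alpha>) *\<^sub>R y)
        \<le> \<alpha> * H x + (1 - \<alpha>) * H y - \<alpha> * (1 - \<alpha>) * \<mu> / 2 * (norm (x - y))\<^sup>2"
begin

definition lin :: "'a \<Rightarrow> 'a \<Rightarrow> real" where
  "lin x u = F x + g x \<bullet> (u - x)"

definition cut :: "'a set \<Rightarrow> 'a \<Rightarrow> real" where
  "cut C u = Max ((\<lambda>x. lin x u) ` C)"

definition prox :: "'a \<Rightarrow> 'a \<Rightarrow> real" where
  "prox c u = 1 / (2 * lam) * (norm (u - c))\<^sup>2"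

definition model :: "'a set \<Rightarrow> 'a \<Rightarrow> 'a \<Rightarrow> real" where
  "model C c u = cut C u + H u + prox c u"

definition phi :: "'a \<Rightarrow> real" where
  "phi u = F u + H u"

text \<open>The reciprocal of the modulus of strong convexity of \<open>H + prox c\<close>.\<close>

definition lam_eff :: real where
  "lam_eff = lam / (1 + lam * \<mu>)"

lemma lam_eff_pos: "lam_eff > 0"
  unfolding lam_eff_def using lam_pos mu_nonneg by (simp add: add_pos_nonneg)

lemma lam_eff_le: "lam_eff \<le> lam"
proof -
  have "1 \<le> 1 + lam * \<mu>" using lam_pos mu_nonneg by simp
  then show ?thesis unfolding lam_eff_def using lam_pos
    by (simp add: divide_le_eq mult_left_mono)
qed

lemma inverse_lam_eff: "1 / lam_eff = 1 / lam + \<mu>"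
  unfolding lam_eff_def using lam_pos by (simp add: field_simps)

lemma prox_nonneg: "prox c u \<ge> 0"
  unfolding prox_def using lam_pos by simp

text \<open>Strong convexity of the proximal term holds with equality; this is what makes its modulus add up
  exactly with the one of \<open>H\<close>.\<close>

lemma prox_combination:
  "prox c (\<alpha> *\<^sub>R x + (1 - \<alpha>) *\<^sub>R y)
     = \<alpha> * prox c x + (1 - \<alpha>) * prox c y - \<alpha> * (1 - \<alpha>) / (2 * lam) * (norm (x - y))\<^sup>2"
proof -
  have split: "\<alpha> *\<^sub>R x + (1 - \<alpha>) *\<^sub>R y - c = \<alpha> *\<^sub>R (x - c) + (1 - \<alpha>) *\<^sub>R (y - c)"
    by (simp add: algebra_simps)
  have diff: "x - y = (x - c) - (y - c)" by simp
  have "(norm (\<alpha> *\<^sub>R x + (1 - \<alpha>) *\<^sub>R y - c))\<^sup>2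
      = \<alpha> * (norm (x - c))\<^sup>2 + (1 - \<alpha>) * (norm (y - c))\<^sup>2 - \<alpha> * (1 - \<alpha>) * (norm (x - y))\<^sup>2"
    unfolding split diff power2_norm_eq_inner
    by (simp add: inner_add_left inner_add_right inner_diff_left inner_diff_right
        inner_commute algebra_simps)
  then show ?thesis unfolding prox_def using lam_pos by (simp add: diff_divide_distrib add_divide_distrib)
qed

lemma lin_combination:
  "lin x (\<alpha> *\<^sub>R u + (1 - \<alpha>) *\<^sub>R v) = \<alpha> * lin x u + (1 - \<alpha>) * lin x v"
  unfolding lin_def by (simp add: inner_diff_right inner_add_right algebra_simps)

lemma lin_le_cut: "\<lbrakk>finite C; x \<in> C\<rbrakk> \<Longrightarrow> lin x u \<le> cut C u"
  unfolding cut_def by simp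

lemma cut_le_iff: "\<lbrakk>finite C; C \<noteq> {}\<rbrakk> \<Longrightarrow> cut C u \<le> b \<longleftrightarrow> (\<forall>x\<in>C. lin x u \<le> b)"
  unfolding cut_def by simp

lemma cut_attained:
  assumes "finite C" "C \<noteq> {}"
  shows "\<exists>x\<in>C. lin x u = cut C u"
proof -
  have "cut C u \<in> (\<lambda>x. lin x u) ` C" unfolding cut_def using assms by (intro Max_in) auto
  then obtain x where "x \<in> C" "cut C u = lin x u" by (rule imageE)
  then show ?thesis by (intro bexI[of _ x]) simp_all
qed

lemma cut_mono: "\<lbrakk>finite C; A \<subseteq> C; A \<noteq> {}\<rbrakk> \<Longrightarrow> cut A u \<le> cut C u"
  unfolding cut_def by (intro Max_mono) auto

lemma model_mono: "\<lbrakk>finite C; A \<subseteq> C; A \<noteq> {}\<rbrakk> \<Longrightarrow> model A c u \<le> model C c u"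
  unfolding model_def using cut_mono by simp

lemma cut_combination:
  assumes "finite C" "C \<noteq> {}" "0 \<le> \<alpha>" "\<alpha> \<le> 1"
  shows "cut C (\<alpha> *\<^sub>R u + (1 - \<alpha>) *\<^sub>R v) \<le> \<alpha> * cut C u + (1 - \<alpha>) * cut C v"
  using assms by (auto simp: cut_le_iff lin_combination intro!: add_mono mult_left_mono lin_le_cut)

lemma cut_le_objective: "\<lbrakk>finite C; C \<noteq> {}; C \<subseteq> D; u \<in> D\<rbrakk> \<Longrightarrow> cut C u \<le> F u"
  using subgradient by (auto simp: cut_le_iff lin_def)

lemma model_le_objective:
  "\<lbrakk>finite C; C \<noteq> {}; C \<subseteq> D; u \<in> D\<rbrakk> \<Longrightarrow> model C c u \<le> phi u + prox c u"
  unfolding model_def phi_def using cut_le_objective by simp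

lemma abs_inner_subgradient: "x \<in> D \<Longrightarrow> \<bar>g x \<bullet> v\<bar> \<le> Mf * norm v"
  by (meson Cauchy_Schwarz_ineq2 mult_right_mono norm_ge_zero order_trans subgradient_bound)

lemma cut_Lipschitz:
  assumes "finite C" "C \<noteq> {}" "C \<subseteq> D"
  shows "cut C u - cut C v \<le> Mf * norm (u - v)"
proof -
  obtain x where x: "x \<in> C" "lin x u = cut C u" using cut_attained[OF assms(1,2)] by blast
  have "lin x u - lin x v = g x \<bullet> (u - v)" unfolding lin_def by (simp add: inner_diff_right)
  also have "\<dots> \<le> Mf * norm (u - v)" using abs_inner_subgradient[of x "u - v"] x assms by auto
  finally show ?thesis using lin_le_cut[OF assms(1) x(1), of v] x(2) by linarith
qed

text \<open>Both subgradients enter, the one at \<open>y\<close> to bound \<open>F y - F x\<close> and the one at \<open>x\<close> in the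
  linearization, which is where the factor 2 comes from.\<close>

lemma linearization_error:
  assumes "x \<in> D" "y \<in> D"
  shows "F y - lin x y \<le> 2 * Mf * norm (y - x)"
proof -
  have "F y + g y \<bullet> (x - y) \<le> F x" using subgradient assms by blast
  moreover have "g y \<bullet> (y - x) \<le> Mf * norm (y - x)" "- (g x \<bullet> (y - x)) \<le> Mf * norm (y - x)"
    using abs_inner_subgradient[of y "y - x"] abs_inner_subgradient[of x "y - x"] assms by auto
  ultimately show ?thesis unfolding lin_def by (simp add: inner_diff_right)
qed

lemma model_error:
  assumes "finite C" "x \<in> C" "C \<subseteq> D" "y \<in> D"
  shows "phi y + prox c y - model C c y \<le> 2 * Mf * norm (y - x)"
  using linearization_error[of x y] lin_le_cut[of C x y] assms
  unfolding phi_def model_def by auto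

text \<open>Near its minimizer \<open>y\<close> the model is determined by the cuts active at \<open>y\<close>. Moving from \<open>y\<close> towards
  \<open>u\<close> by a small fraction \<open>\<theta>\<close>, the model cannot decrease, while strong convexity of the model with
  active cuts bounds its value there by a combination of the values at \<open>y\<close> and \<open>u\<close>. Dividing by
  \<open>\<theta>\<close> and letting \<open>\<theta>\<close> tend to 0 gives the claim. It is the reason why discarding inactive cuts at a
  null step does no harm.\<close>

lemma model_growth:
  assumes C: "finite C" "C \<noteq> {}" and y: "y \<in> D" and u: "u \<in> D"
    and min: "\<And>v. v \<in> D \<Longrightarrow> model C c y \<le> model C c v"
  defines "A \<equiv> {x \<in> C. lin x y = cut C y}"
  shows "model C c y + (norm (u - y))\<^sup>2 / (2 * lam_eff) \<le> model A c u"
proof -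
  define w where "w \<theta> = \<theta> *\<^sub>R u + (1 - \<theta>) *\<^sub>R y" for \<theta> :: real
  define n2 where "n2 = (norm (u - y))\<^sup>2"
  obtain a where a: "a \<in> A" using cut_attained[OF C, of y] unfolding A_def by auto
  have A: "finite A" "A \<noteq> {}" "A \<subseteq> C" using C a unfolding A_def by auto
  have cutA: "cut A y = cut C y"
    using lin_le_cut[OF A(1) a, of y] cut_mono[OF C(1) A(3,2), of y] a unfolding A_def by simp
  \<comment> \<open>A cut that is not active at \<open>y\<close> stays below the active cut at \<open>a\<close> for a while.\<close>
  have inactive: "\<forall>\<^sub>F \<theta> in at_right 0. lin x (w \<theta>) < lin a (w \<theta>)" if x: "x \<in> C - A" for x
  proof -
    have "lin x y < lin a y"
      using x a lin_le_cut[OF C(1), of x y] unfolding A_def by force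
    moreover have "((\<lambda>\<theta>. lin z (w \<theta>)) \<longlongrightarrow> lin z y) (at_right 0)" for z
      unfolding w_def lin_combination by (auto intro!: tendsto_eq_intros)
    ultimately have "(\<forall>\<^sub>F \<theta> in at_right 0. lin a (w \<theta>) - lin x (w \<theta>) > 0)"
      by (intro order_tendstoD(1)[of _ "lin a y - lin x y"] tendsto_diff) auto
    then show ?thesis by eventually_elim simp
  qed
  have "\<forall>\<^sub>F \<theta> in at_right 0. \<forall>x\<in>C - A. lin x (w \<theta>) < lin a (w \<theta>)"
    using inactive C by (intro eventually_ball_finite) auto
  moreover have "\<forall>\<^sub>F \<theta>::real in at_right 0. 0 < \<theta> \<and> \<theta> < 1"
    by (auto simp: eventually_at_right_field intro: exI[of _ 1])
  ultimately have "\<forall>\<^sub>F \<theta> in at_right 0.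
      model C c y + (1 - \<theta>) * (n2 / (2 * lam_eff)) \<le> model A c u"
  proof eventually_elim
    case (elim \<theta>)
    have "cut C (w \<theta>) \<le> cut A (w \<theta>)"
    proof (subst cut_le_iff[OF C], intro ballI)
      fix x assume "x \<in> C"
      show "lin x (w \<theta>) \<le> cut A (w \<theta>)"
      proof (cases "x \<in> A")
        case True then show ?thesis using lin_le_cut[OF A(1)] by simp
      next
        case False
        then have "lin x (w \<theta>) < lin a (w \<theta>)" using elim \<open>x \<in> C\<close> by blast
        then show ?thesis using lin_le_cut[OF A(1) a, of "w \<theta>"] by simp
      qed
    qed
    also have "\<dots> \<le> \<theta> * cut A u + (1 - \<theta>) * cut C y"
      using cut_combination[OF A(1,2), of \<theta> u y] elim unfolding w_def cutA by simp
    finally have 1: "cut C (w \<theta>) \<le> \<theta> * cut A u + (1 - \<theta>) * cut C y" .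
    have 2: "H (w \<theta>) \<le> \<theta> * H u + (1 - \<theta>) * H y - \<theta> * (1 - \<theta>) * \<mu> / 2 * n2"
      unfolding w_def n2_def using elim by (intro strongly_convex u y) auto
    have 3: "prox c (w \<theta>) = \<theta> * prox c u + (1 - \<theta>) * prox c y - \<theta> * (1 - \<theta>) / (2 * lam) * n2"
      unfolding w_def n2_def by (rule prox_combination)
    have "w \<theta> \<in> D" unfolding w_def using elim by (intro convex_dom u y) auto
    then have "model C c y \<le> model C c (w \<theta>)" by (rule min)
    also have "\<dots> \<le> \<theta> * model A c u + (1 - \<theta>) * model C c y
        - \<theta> * (1 - \<theta>) * ((1 / lam + \<mu>) / 2 * n2)"
    proof -
      define i where "i = 1 / lam"
      have 3: "prox c (w \<theta>) = \<theta> * prox c u + (1 - \<theta>) * prox c y - \<theta> * (1 - \<theta>) * i / 2 * n2"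
        using 3 unfolding i_def by simp
      have "\<theta> * model A c u + (1 - \<theta>) * model C c y - \<theta> * (1 - \<theta>) * ((i + \<mu>) / 2 * n2)
          = (\<theta> * cut A u + (1 - \<theta>) * cut C y)
            + (\<theta> * H u + (1 - \<theta>) * H y - \<theta> * (1 - \<theta>) * \<mu> / 2 * n2)
            + (\<theta> * prox c u + (1 - \<theta>) * prox c y - \<theta> * (1 - \<theta>) * i / 2 * n2)"
        unfolding model_def by (simp add: field_simps)
      then show ?thesis using 1 2 3 unfolding model_def i_def[symmetric] by linarith
    qed
    also have "(1 / lam + \<mu>) / 2 * n2 = n2 / (2 * lam_eff)"
      using inverse_lam_eff[symmetric] by simp
    finally have "\<theta> * (model C c y + (1 - \<theta>) * (n2 / (2 * lam_eff))) \<le> \<theta> * model A c u"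
      by (simp add: algebra_simps)
    then show ?case using elim by (simp add: mult_le_cancel_left_pos)
  qed
  moreover have "((\<lambda>\<theta>. model C c y + (1 - \<theta>) * (n2 / (2 * lam_eff)))
      \<longlongrightarrow> model C c y + (1 - 0) * (n2 / (2 * lam_eff))) (at_right 0)"
    by (intro tendsto_intros)
  ultimately show ?thesis
    unfolding n2_def[symmetric]
    using tendsto_upperbound[of "\<lambda>\<theta>. model C c y + (1 - \<theta>) * (n2 / (2 * lam_eff))"] by fastforce
qed

lemma model_growth_whole:
  assumes C: "finite C" "C \<noteq> {}" and y: "y \<in> D" and u: "u \<in> D"
    and min: "\<And>v. v \<in> D \<Longrightarrow> model C c y \<le> model C c v"
  shows "model C c y + (norm (u - y))\<^sup>2 / (2 * lam_eff) \<le> model C c u"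
proof -
  have "{x \<in> C. lin x y = cut C y} \<noteq> {}" using cut_attained[OF C] by blast
  then show ?thesis
    using model_growth[OF C y u min] model_mono[OF C(1), of "{x \<in> C. lin x y = cut C y}" c u]
    by fastforce
qed

text \<open>Compare the model at its minimizer with the model at the center: the step must pay for the
  proximal term and for the quadratic growth with the variation of the Lipschitz part, so its length
  satisfies \<open>n\<^sup>2 / \<lambda> \<le> (M\<^sub>f + M\<^sub>h) n\<close>.\<close>

lemma step_length_Lipschitz:
  assumes C: "finite C" "C \<noteq> {}" "C \<subseteq> D" and y: "y \<in> D" and c: "c \<in> D"
    and min: "\<And>v. v \<in> D \<Longrightarrow> model C c y \<le> model C c v"
    and Lip: "H c - H y \<le> mh * norm (c - y)" and mh: "mh \<ge> 0"
  shows "norm (y - c) \<le> lam * (Mf + mh)"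
proof (cases "y = c")
  case True
  have "0 \<le> Mf" using subgradient_bound[OF c] norm_ge_zero order_trans by blast
  then show ?thesis using True mh lam_pos by simp
next
  case False
  define n where "n = norm (y - c)"
  have n: "n > 0" using False unfolding n_def by simp
  have cy: "norm (c - y) = n" unfolding n_def by (rule norm_minus_commute)
  have "model C c y + n\<^sup>2 / (2 * lam_eff) \<le> model C c c"
    using model_growth_whole[OF C(1,2) y c min] cy by simp
  moreover have "cut C c - cut C y \<le> Mf * n" using cut_Lipschitz[OF C, of c y] cy by simp
  moreover have "n\<^sup>2 / (2 * lam) \<le> n\<^sup>2 / (2 * lam_eff)"
    using lam_eff_pos lam_eff_le by (intro divide_left_mono) auto
  ultimately have "n\<^sup>2 / (2 * lam) + n\<^sup>2 / (2 * lam) \<le> (Mf + mh) * n"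
    using Lip unfolding model_def prox_def n_def[symmetric] cy by (simp add: algebra_simps)
  then have "n * n \<le> (lam * (Mf + mh)) * n"
    using lam_pos by (simp add: field_simps power2_eq_square)
  then show ?thesis using n unfolding n_def[symmetric] by simp
qed

text \<open>If nothing is known about the variation of \<open>H\<close>, compare with a point \<open>s\<close> that is at least as good as
  \<open>y\<close>. With \<open>e = \<parallel>s - y\<parallel>\<close>, \<open>d = \<parallel>c - s\<parallel>\<close> and \<open>p = 2 \<lambda>' M\<^sub>f\<close> the quadratic growth of the model and its
  accuracy at \<open>y\<close> give \<open>e\<^sup>2 \<le> 2 p (e + d) + d\<^sup>2\<close>, and completing the square on both sides yields
  \<open>e \<le> 2 p + d\<close>.\<close>

lemma step_length_minimizer:
  assumes C: "finite C" "C \<subseteq> D" and y: "y \<in> D" and c: "c \<in> C" and s: "s \<in> D"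
    and min: "\<And>v. v \<in> D \<Longrightarrow> model C c y \<le> model C c v"
    and opt: "phi s \<le> phi y"
  shows "norm (y - c) \<le> 4 * lam_eff * Mf + 2 * norm (c - s)"
proof -
  define d e n where "d = norm (c - s)" and "e = norm (s - y)" and "n = norm (y - c)"
  define p where "p = 2 * lam_eff * Mf"
  have "0 \<le> Mf" using subgradient_bound[of c] norm_ge_zero[of "g c"] c C by (meson order_trans subsetD)
  then have p: "p \<ge> 0" unfolding p_def using lam_eff_pos by simp
  have nonneg: "d \<ge> 0" "e \<ge> 0" "n \<ge> 0" unfolding d_def e_def n_def by auto
  have tri: "n \<le> e + d"
    unfolding n_def e_def d_def
    by (metis add.commute norm_minus_commute norm_triangle_ineq add_diff_eq diff_add_cancel)
  have ne: "C \<noteq> {}" using c by auto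
  have "model C c y + e\<^sup>2 / (2 * lam_eff) \<le> phi s + prox c s"
    using model_growth_whole[OF C(1) ne y s min] model_le_objective[OF C(1) ne C(2) s, of c]
    unfolding e_def by linarith
  moreover have "phi y + prox c y - model C c y \<le> 2 * Mf * n"
    unfolding n_def by (rule model_error[OF C(1) c C(2) y])
  moreover have "prox c s \<le> d\<^sup>2 / (2 * lam_eff)"
    unfolding prox_def d_def norm_minus_commute[of s c] using lam_eff_pos lam_eff_le lam_pos
    by (auto intro!: divide_left_mono)
  ultimately have "e\<^sup>2 / (2 * lam_eff) \<le> 2 * Mf * n + d\<^sup>2 / (2 * lam_eff)"
    using opt prox_nonneg[of c y] by linarith
  then have "e\<^sup>2 \<le> 2 * p * n + d\<^sup>2"
    unfolding p_def using lam_eff_pos by (simp add: field_simps)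
  also have "\<dots> \<le> 2 * p * (e + d) + d\<^sup>2" using tri p by (simp add: mult_left_mono)
  finally have "(e - p)\<^sup>2 \<le> (p + d)\<^sup>2" by (simp add: power2_eq_square algebra_simps)
  then have "e - p \<le> p + d" using p nonneg by (intro power2_le_imp_le[of "e - p"]) auto
  then show ?thesis using tri unfolding p_def n_def[symmetric] d_def[symmetric] by (simp add: algebra_simps)
qed

text \<open>The model is below the proximal objective at \<open>s\<close> and grows quadratically from \<open>y\<close>, and its minimum
  is within \<open>\<epsilon> / 2\<close> of the objective at \<open>z\<close>, which exceeds \<open>phi s\<close> by more than \<open>\<epsilon>\<close>; half of \<open>\<epsilon>\<close>
  survives as a decrease.\<close>

lemma serious_descent:
  assumes C: "finite C" "C \<noteq> {}" "C \<subseteq> D" and y: "y \<in> D" and s: "s \<in> D"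
    and min: "\<And>v. v \<in> D \<Longrightarrow> model C c y \<le> model C c v"
    and gap: "phi z + prox c z - model C c y \<le> \<epsilon> / 2"
    and far: "phi z - phi s > \<epsilon>"
  shows "(1 + lam * \<mu>) * (norm (y - s))\<^sup>2 + lam * \<epsilon> \<le> (norm (c - s))\<^sup>2"
proof -
  have "model C c y + (norm (s - y))\<^sup>2 / (2 * lam_eff) \<le> phi s + prox c s"
    using model_growth_whole[OF C(1,2) y s min] model_le_objective[OF C s, of c] by linarith
  then have "\<epsilon> / 2 + (norm (s - y))\<^sup>2 / (2 * lam_eff) \<le> prox c s"
    using gap far prox_nonneg[of c z] by linarith
  then have "\<epsilon> / 2 + (1 + lam * \<mu>) * (norm (y - s))\<^sup>2 / (2 * lam) \<le> (norm (c - s))\<^sup>2 / (2 * lam)"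
    unfolding prox_def norm_minus_commute[of s y] norm_minus_commute[of s c] lam_eff_def
    by (simp add: field_simps)
  moreover have "\<epsilon> / 2 = lam * \<epsilon> / (2 * lam)" using lam_pos by simp
  ultimately have "((1 + lam * \<mu>) * (norm (y - s))\<^sup>2 + lam * \<epsilon>) / (2 * lam) \<le> (norm (c - s))\<^sup>2 / (2 * lam)"
    by (simp add: add_divide_distrib)
  then show ?thesis using lam_pos by (simp add: divide_le_cancel)
qed

text \<open>One null step, from the minimizer \<open>y\<close> of the model with bundle \<open>C\<close> to a point \<open>y'\<close> and a bundle \<open>C'\<close>
  around the same center. The growth of the part of the model that survives in \<open>C'\<close> bounds
  \<open>\<parallel>y' - y\<parallel>\<close> from above by the decrease of the gap, and the cut at \<open>y\<close> bounds it from below by the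
  new gap.\<close>

lemma null_step_gap:
  assumes C: "finite C" "C \<noteq> {}" and y: "y \<in> D"
    and min: "\<And>v. v \<in> D \<Longrightarrow> model C c y \<le> model C c v"
    and C': "finite C'" "C' \<subseteq> D" "{x \<in> C. lin x y = cut C y} \<union> {y} \<subseteq> C'"
    and y': "y' \<in> D"
    and z: "phi z' + prox c z' \<le> phi z + prox c z" "phi z' + prox c z' \<le> phi y' + prox c y'"
    and pos: "0 \<le> phi z' + prox c z' - model C' c y'"
  shows "(phi z' + prox c z' - model C' c y')\<^sup>2
    \<le> 8 * lam_eff * Mf\<^sup>2 * ((phi z + prox c z - model C c y) - (phi z' + prox c z' - model C' c y'))"
proof -
  define t t' n where "t = phi z + prox c z - model C c y"
    and "t' = phi z' + prox c z' - model C' c y'" and "n = norm (y' - y)"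
  have "{x \<in> C. lin x y = cut C y} \<noteq> {}" using cut_attained[OF C] by blast
  then have "model C c y + n\<^sup>2 / (2 * lam_eff) \<le> model C' c y'"
    unfolding n_def
    using model_growth[OF C y y' min] C'
      model_mono[OF C'(1), of "{x \<in> C. lin x y = cut C y}" c y'] by fastforce
  then have "n\<^sup>2 / (2 * lam_eff) \<le> t - t'" unfolding t_def t'_def using z(1) by linarith
  then have n2: "n\<^sup>2 \<le> 2 * lam_eff * (t - t')" using lam_eff_pos by (simp add: field_simps)
  have "t' \<le> 2 * Mf * n"
    unfolding t'_def n_def using model_error[OF C'(1) _ C'(2) y', of y c] C'(3) z(2) by auto
  then have "t'\<^sup>2 \<le> (2 * Mf * n)\<^sup>2" using pos unfolding t'_def by (intro power_mono)
  also have "\<dots> = 4 * Mf\<^sup>2 * n\<^sup>2" by (simp add: power_mult_distrib)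
  also have "\<dots> \<le> 4 * Mf\<^sup>2 * (2 * lam_eff * (t - t'))" using n2 by (intro mult_left_mono) auto
  finally show ?thesis unfolding t_def t'_def by (simp add: algebra_simps)
qed

end


section \<open>Sequences with quadratically controlled decrease\<close>

text \<open>The reciprocals grow at least linearly: from \<open>s\<^sup>2 \<le> A (t - s)\<close> follows
  \<open>1 / s - 1 / t \<ge> 1 / (A + s)\<close>, and the right-hand side is at least \<open>1 / (A + t 0)\<close> since the sequence
  decreases. Measuring the progress against \<open>A + t 0\<close> rather than \<open>A\<close> avoids a separate, logarithmic
  count of the steps at which the sequence drops by a large factor.\<close>

lemma sublinear_decrease_length:
  fixes t :: "nat \<Rightarrow> real"
  assumes "A \<ge> 0" "\<delta> > 0" "p > 0"
    and large: "\<And>i. i < p \<Longrightarrow> t i > \<delta>"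
    and decrease: "\<And>i. Suc i < p \<Longrightarrow> (t (Suc i))\<^sup>2 \<le> A * (t i - t (Suc i))"
  shows "p * \<delta> \<le> A + t 0"
proof -
  have t0: "t 0 > 0" using large[of 0] \<open>p > 0\<close> \<open>\<delta> > 0\<close> by simp
  have "t i \<le> t 0 \<and> 1 / t 0 + i / (A + t 0) \<le> 1 / t i" if "i < p" for i
    using that
  proof (induction i)
    case (Suc i)
    define s where "s = t (Suc i)"
    have pos: "t i > 0" "s > 0" using large[of i] large[of "Suc i"] Suc.prems \<open>\<delta> > 0\<close> unfolding s_def by auto
    have dec: "s\<^sup>2 \<le> A * (t i - s)" unfolding s_def using decrease Suc.prems by simp
    have "0 < A * (t i - s)" using dec pos by (meson less_le_trans zero_less_power)
    then have less: "s < t i" using \<open>A \<ge> 0\<close> by (simp add: zero_less_mult_iff)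
    have IH: "t i \<le> t 0" "1 / t 0 + i / (A + t 0) \<le> 1 / t i" using Suc by auto
    have "1 / (A + t 0) \<le> 1 / (A + s)"
      using less IH(1) pos \<open>A \<ge> 0\<close> by (intro divide_left_mono) auto
    also have "\<dots> \<le> 1 / s - 1 / t i"
    proof -
      have "t i * s \<le> (t i - s) * (A + s)" using dec by (simp add: algebra_simps power2_eq_square)
      then show ?thesis using pos \<open>A \<ge> 0\<close> by (simp add: field_simps)
    qed
    finally have "1 / t 0 + Suc i / (A + t 0) \<le> 1 / s"
      using IH(2) by (simp add: add_divide_distrib)
    then show ?case using less IH(1) unfolding s_def by simp
  qed simp
  from this[of "p - 1"] have "1 / t 0 + (real p - 1) / (A + t 0) \<le> 1 / t (p - 1)"
    using \<open>p > 0\<close> by (simp add: of_nat_diff)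
  also have "\<dots> \<le> 1 / \<delta>" using large[of "p - 1"] \<open>p > 0\<close> \<open>\<delta> > 0\<close> by (simp add: frac_le)
  finally have "1 / (A + t 0) + (real p - 1) / (A + t 0) \<le> 1 / \<delta>"
    using t0 \<open>A \<ge> 0\<close> divide_left_mono[of "t 0" "A + t 0" 1] by fastforce
  then have "p / (A + t 0) \<le> 1 / \<delta>" by (simp add: diff_divide_distrib)
  then show ?thesis using t0 \<open>A \<ge> 0\<close> \<open>\<delta> > 0\<close> by (simp add: field_simps)
qed


section \<open>Runs of the method in real numbers\<close>

locale rpb_execution =
  fixes f h :: "'a::euclidean_space \<Rightarrow> ereal" and f' :: "'a \<Rightarrow> 'a"
    and Mf :: real and Mh :: ereal and \<mu> :: real and x\<^sub>0 :: 'a and lam \<epsilon> :: real and r :: "'a rpb_run"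
  assumes Mf_nonneg: "Mf \<ge> 0" and Mh_nonneg: "Mh \<ge> 0" and mu_nonneg: "\<mu> \<ge> 0"
    and basic: "basic_assumptions f f' h Mf Mh \<mu>"
    and start: "x\<^sub>0 \<in> edom h" and lam_pos: "lam > 0" and eps_pos: "\<epsilon> > 0"
    and run: "rpb f f' h x\<^sub>0 lam (\<epsilon> / 2) r"
begin

lemma f_finite: "x \<in> edom h \<Longrightarrow> f x = ereal (real_of_ereal (f x))"
  using basic unfolding basic_assumptions_def proper_def edom_def
  by (cases "f x") auto

lemma h_finite: "x \<in> edom h \<Longrightarrow> h x = ereal (real_of_ereal (h x))"
  using basic unfolding basic_assumptions_def proper_def edom_def
  by (cases "h x") auto

lemma h_combination:
  assumes "x \<in> edom h" "y \<in> edom h" "0 \<le> \<alpha>" "\<alpha> \<le> 1"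
  shows "h (\<alpha> *\<^sub>R x + (1 - \<alpha>) *\<^sub>R y)
    \<le> ereal (\<alpha> * real_of_ereal (h x) + (1 - \<alpha>) * real_of_ereal (h y)
        - \<alpha> * (1 - \<alpha>) * \<mu> / 2 * (norm (x - y))\<^sup>2)"
proof -
  have "mu_convex \<mu> h" using basic unfolding basic_assumptions_def by simp
  then have "h (\<alpha> *\<^sub>R x + (1 - \<alpha>) *\<^sub>R y) \<le> ereal \<alpha> * h x + ereal (1 - \<alpha>) * h y
      - ereal (\<alpha> * (1 - \<alpha>) * \<mu> / 2 * (norm (x - y))\<^sup>2)"
    unfolding mu_convex_def using assms by auto
  moreover obtain a b where "h x = ereal a" "h y = ereal b"
    using h_finite assms by blast
  ultimately show ?thesis by simp
qed

sublocale composite_convex "edom h" "\<lambda>x. real_of_ereal (f x)" "\<lambda>x. real_of_ereal (h x)" f' Mf \<mu> lam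
proof
  show "lam > 0" "\<mu> \<ge> 0" by (fact lam_pos mu_nonneg)+
  show *: "\<alpha> *\<^sub>R x + (1 - \<alpha>) *\<^sub>R y \<in> edom h"
    if "x \<in> edom h" "y \<in> edom h" "0 \<le> \<alpha>" "\<alpha> \<le> 1" for x y \<alpha>
    using h_combination[OF that] unfolding edom_def by auto
  show "real_of_ereal (h (\<alpha> *\<^sub>R x + (1 - \<alpha>) *\<^sub>R y)) \<le> \<alpha> * real_of_ereal (h x)
      + (1 - \<alpha>) * real_of_ereal (h y) - \<alpha> * (1 - \<alpha>) * \<mu> / 2 * (norm (x - y))\<^sup>2"
    if "x \<in> edom h" "y \<in> edom h" "0 \<le> \<alpha>" "\<alpha> \<le> 1" for x y \<alpha>
    using h_combination[OF that] by (subst (asm) h_finite[OF *[OF that]]) simp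
  show "real_of_ereal (f x) + f' x \<bullet> (y - x) \<le> real_of_ereal (f y)"
    if xy: "x \<in> edom h" "y \<in> edom h" for x y
  proof -
    have "f x + ereal (f' x \<bullet> (y - x)) \<le> f y"
      using basic xy unfolding basic_assumptions_def subdifferential_def by auto
    moreover obtain a b where "f x = ereal a" "f y = ereal b"
      using f_finite xy by blast
    ultimately show ?thesis by simp
  qed
  show "norm (f' x) \<le> Mf" if "x \<in> edom h" for x
    using basic that unfolding basic_assumptions_def by auto
qed

lemma linearization_eq: "x \<in> edom h \<Longrightarrow> linearization f f' x u = ereal (lin x u)"
  unfolding linearization_def lin_def by (subst f_finite) simp_all

lemma cutting_plane_eq:
  assumes "finite C" "C \<noteq> {}" "C \<subseteq> edom h"
  shows "cutting_plane f f' C u = ereal (cut C u)"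
proof -
  have "(\<lambda>x. linearization f f' x u) ` C = ereal ` (\<lambda>x. lin x u) ` C"
    unfolding image_image using linearization_eq assms by (intro image_cong) auto
  then show ?thesis unfolding cutting_plane_def cut_def
    using assms mono_Max_commute[of ereal "(\<lambda>x. lin x u) ` C"] by (simp add: mono_def)
qed

lemma objective_eq: "u \<in> edom h \<Longrightarrow> objective f h u = ereal (phi u)"
  unfolding objective_def phi_def by (subst f_finite, simp, subst h_finite) simp_all

lemma objective_edom: "objective f h u < \<infinity> \<Longrightarrow> u \<in> edom h"
  using basic unfolding objective_def edom_def basic_assumptions_def proper_def by auto

lemma prox_objective_eq:
  "u \<in> edom h \<Longrightarrow> prox_objective f h lam c u = ereal (phi u + prox c u)"
  unfolding prox_objective_def prox_term_def prox_def by (simp add: objective_eq)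

lemma prox_model_eq:
  assumes "finite C" "C \<noteq> {}" "C \<subseteq> edom h" "u \<in> edom h"
  shows "prox_model f f' h lam C c u = ereal (model C c u)"
  unfolding prox_model_def cutting_plane_eq[OF assms(1-3)] prox_term_def model_def prox_def
  by (subst h_finite[OF assms(4)]) simp

lemma prox_model_edom:
  assumes "finite C" "C \<noteq> {}" "C \<subseteq> edom h" "prox_model f f' h lam C c u < \<infinity>"
  shows "u \<in> edom h"
  using assms(4) unfolding prox_model_def cutting_plane_eq[OF assms(1-3)] prox_term_def edom_def
  by (cases "h u") auto

abbreviation serious_index :: "nat \<Rightarrow> bool" where
  "serious_index \<equiv> serious f f' h lam (\<epsilon> / 2) r"

lemma run_init:
  "iter r 0 = x\<^sub>0" "center r 0 = x\<^sub>0" "aux_pt r 0 = x\<^sub>0" "zhat r 0 = x\<^sub>0"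
  "cuts r (Suc 0) = {x\<^sub>0}" "counter r 0 = 1"
  using run unfolding rpb_def by auto

lemmas run_iteration = run[unfolded rpb_def, THEN conjunct2, THEN conjunct2, THEN conjunct2,
    THEN conjunct2, THEN conjunct2, THEN conjunct2]

lemma run_step:
  "is_arg_min (prox_model f f' h lam (cuts r (Suc j)) (center r j)) (\<lambda>_. True) (iter r (Suc j))"
  "is_arg_min (prox_objective f h lam (center r j))
     (\<lambda>u. u \<in> {iter r (Suc j), aux_pt r j}) (aux_pt r (Suc j))"
  using run_iteration[rule_format, of "Suc j"] by auto

lemma run_serious:
  assumes "serious_index (Suc j)"
  shows "iter r (Suc j) \<in> cuts r (Suc (Suc j))" "cuts r (Suc (Suc j)) \<subseteq> iter r ` {0..Suc j}"
    "center r (Suc j) = iter r (Suc j)" "counter r (Suc j) = counter r j + 1"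
    "is_arg_min (objective f h) (\<lambda>u. u \<in> {zhat r (counter r j - 1), aux_pt r (Suc j)})
       (zhat r (counter r j))"
  using run_iteration[rule_format, of "Suc j"] assms by auto

lemma run_null:
  assumes "\<not> serious_index (Suc j)"
  shows "center r (Suc j) = center r j" "active f f' r (Suc j) \<union> {iter r (Suc j)} \<subseteq> cuts r (Suc (Suc j))"
    "cuts r (Suc (Suc j)) \<subseteq> cuts r (Suc j) \<union> {iter r (Suc j)}" "counter r (Suc j) = counter r j"
  using run_iteration[rule_format, of "Suc j"] assms by auto

text \<open>The three claims have to be proved together: the model is finite at \<open>x\<^sub>0\<close>, hence its minimizer
  lies in the domain, only if the cuts of the current bundle were generated at points of the
  domain.\<close>

lemma iterates_and_bundles:
  "(\<forall>i\<le>j. iter r i \<in> edom h) \<and> iter r j \<in> cuts r (Suc j) \<and> cuts r (Suc j) \<subseteq> iter r ` {0..j}"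
proof (induction j)
  case 0
  then show ?case using start by (simp add: run_init)
next
  case (Suc j)
  have C: "finite (cuts r (Suc j))" "cuts r (Suc j) \<noteq> {}" "cuts r (Suc j) \<subseteq> edom h"
  proof -
    have sub: "cuts r (Suc j) \<subseteq> iter r ` {0..j}" using Suc by blast
    then show "finite (cuts r (Suc j))" by (rule finite_subset) simp
    show "cuts r (Suc j) \<noteq> {}" using Suc by blast
    show "cuts r (Suc j) \<subseteq> edom h" using sub Suc by fastforce
  qed
  have "prox_model f f' h lam (cuts r (Suc j)) (center r j) (iter r (Suc j))
      \<le> prox_model f f' h lam (cuts r (Suc j)) (center r j) x\<^sub>0"
    using run_step(1)[of j] by (auto simp: is_arg_min_linorder)
  also have "\<dots> < \<infinity>" unfolding prox_model_eq[OF C start] by simp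
  finally have "iter r (Suc j) \<in> edom h" by (rule prox_model_edom[OF C])
  moreover have "iter r (Suc j) \<in> cuts r (Suc (Suc j))"
    using run_serious(1) run_null(2) by blast
  moreover have "cuts r (Suc (Suc j)) \<subseteq> iter r ` {0..Suc j}"
  proof (cases "serious_index (Suc j)")
    case False
    have "cuts r (Suc j) \<subseteq> iter r ` {0..j}" using Suc by blast
    then show ?thesis using run_null(3)[OF False] by fastforce
  qed (rule run_serious(2))
  ultimately show ?case using Suc by (simp add: le_Suc_eq)
qed

lemma iter_edom: "iter r j \<in> edom h"
  using iterates_and_bundles by blast

lemma bundle_dom: "finite (cuts r (Suc j))" "cuts r (Suc j) \<noteq> {}" "cuts r (Suc j) \<subseteq> edom h"
  "iter r j \<in> cuts r (Suc j)"
proof -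
  have sub: "cuts r (Suc j) \<subseteq> iter r ` {0..j}" and mem: "iter r j \<in> cuts r (Suc j)"
    using iterates_and_bundles[of j] by blast+
  show "finite (cuts r (Suc j))" using sub by (rule finite_subset) simp
  show "cuts r (Suc j) \<noteq> {}" "iter r j \<in> cuts r (Suc j)" using mem by blast+
  show "cuts r (Suc j) \<subseteq> edom h" using sub iter_edom by fastforce
qed

lemma aux_edom: "aux_pt r j \<in> edom h"
proof (induction j)
  case 0
  then show ?case using start by (simp add: run_init)
next
  case (Suc j)
  then show ?case using run_step(2)[of j] iter_edom[of "Suc j"] by (auto simp: is_arg_min_linorder)
qed

lemma aux_le:
  "phi (aux_pt r (Suc j)) + prox (center r j) (aux_pt r (Suc j))
     \<le> phi (iter r (Suc j)) + prox (center r j) (iter r (Suc j))"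
  "phi (aux_pt r (Suc j)) + prox (center r j) (aux_pt r (Suc j))
     \<le> phi (aux_pt r j) + prox (center r j) (aux_pt r j)"
  using run_step(2)[of j]
  by (auto simp: is_arg_min_linorder prox_objective_eq aux_edom iter_edom)

lemma iter_minimizes:
  assumes "v \<in> edom h"
  shows "model (cuts r (Suc j)) (center r j) (iter r (Suc j)) \<le> model (cuts r (Suc j)) (center r j) v"
  using run_step(1)[of j] prox_model_eq[OF bundle_dom(1-3) assms, of j "center r j"]
    prox_model_eq[OF bundle_dom(1-3) iter_edom, of j "center r j" "Suc j"]
  by (auto simp: is_arg_min_linorder) (metis ereal_less_eq(3))

text \<open>The gap \<open>t\<^sub>j\<close> for \<open>j = Suc i\<close>, so that no index has to be positive. The infimum of the model is
  taken at the iterate.\<close>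

definition gap_succ :: "nat \<Rightarrow> real" where
  "gap_succ i = phi (aux_pt r (Suc i)) + prox (center r i) (aux_pt r (Suc i))
     - model (cuts r (Suc i)) (center r i) (iter r (Suc i))"

lemma serious_index_Suc: "serious_index (Suc i) \<longleftrightarrow> gap_succ i \<le> \<epsilon> / 2"
proof -
  have "(INF u. prox_model f f' h lam (cuts r (Suc i)) (center r i) u)
      = prox_model f f' h lam (cuts r (Suc i)) (center r i) (iter r (Suc i))"
    using run_step(1)[of i] by (intro INF_eqI) (auto simp: is_arg_min_linorder)
  then have "gap f f' h lam r (Suc i) = ereal (gap_succ i)"
    unfolding gap_def gap_succ_def
    by (simp add: prox_objective_eq aux_edom prox_model_eq[OF bundle_dom(1-3) iter_edom])
  then show ?thesis unfolding serious_def by simp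
qed

text \<open>The cut at the preceding iterate is in the bundle after serious and null iterations alike, so
  this holds at the first step of a cycle as well, where the preceding iterate is the center.\<close>

lemma gap_succ_le: "gap_succ i \<le> 2 * Mf * norm (iter r (Suc i) - iter r i)"
  using model_error[OF bundle_dom(1,4,3)[of i] iter_edom[of "Suc i"], of "center r i"] aux_le(1)[of i]
  unfolding gap_succ_def by linarith

lemma gap_succ_null_step:
  assumes "\<not> serious_index (Suc i)" "gap_succ (Suc i) \<ge> 0"
  shows "(gap_succ (Suc i))\<^sup>2 \<le> 8 * lam_eff * Mf\<^sup>2 * (gap_succ i - gap_succ (Suc i))"
proof -
  have c: "center r (Suc i) = center r i" by (rule run_null(1)[OF assms(1)])
  have act: "{x \<in> cuts r (Suc i). lin x (iter r (Suc i)) = cut (cuts r (Suc i)) (iter r (Suc i))}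
      = active f f' r (Suc i)"
    unfolding active_def cutting_plane_eq[OF bundle_dom(1-3)]
    using linearization_eq[OF subsetD[OF bundle_dom(3)]] by (intro Collect_cong) auto
  show ?thesis
    unfolding gap_succ_def c
  proof (rule null_step_gap[OF bundle_dom(1,2)[of i] iter_edom iter_minimizes
        bundle_dom(1,3)[of "Suc i"] _ iter_edom])
    show "{x \<in> cuts r (Suc i). lin x (iter r (Suc i)) = cut (cuts r (Suc i)) (iter r (Suc i))}
        \<union> {iter r (Suc i)} \<subseteq> cuts r (Suc (Suc i))"
      unfolding act by (rule run_null(2)[OF assms(1)])
  qed (use aux_le[of "Suc i"] assms(2) in \<open>simp_all add: gap_succ_def c\<close>)
qed


section \<open>The number of serious iterations\<close>

definition unsolved :: "nat \<Rightarrow> bool" where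
  "unsolved j \<longleftrightarrow> (\<forall>k<counter r j. \<not> eps_solution f h \<epsilon> (zhat r k))"

definition serious_count :: "nat \<Rightarrow> nat" where
  "serious_count N = card {j \<in> {1..N}. serious_index j}"

lemma serious_count_0 [simp]: "serious_count 0 = 0"
  unfolding serious_count_def by simp

lemma serious_count_Suc [simp]:
  "serious_count (Suc N) = serious_count N + (if serious_index (Suc N) then 1 else 0)"
proof -
  have "{j \<in> {1..Suc N}. serious_index j}
      = (if serious_index (Suc N) then insert (Suc N) {j \<in> {1..N}. serious_index j}
         else {j \<in> {1..N}. serious_index j})"
    by (auto simp: le_Suc_eq)
  then show ?thesis unfolding serious_count_def by simp
qed

lemma counter_Suc: "counter r (Suc j) = counter r j + (if serious_index (Suc j) then 1 else 0)"
  using run_serious(4)[of j] run_null(4)[of j] by simp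

lemma unsolved_mono:
  assumes "unsolved j" "i \<le> j"
  shows "unsolved i"
proof -
  have "mono (counter r)" unfolding mono_iff_le_Suc counter_Suc by simp
  then show ?thesis
    using assms unfolding unsolved_def by (meson less_le_trans monoD)
qed

lemma solution:
  assumes "s \<in> solutions f h"
  shows "s \<in> edom h" "opt_value f h = ereal (phi s)" "u \<in> edom h \<Longrightarrow> phi s \<le> phi u"
proof -
  have min: "objective f h s \<le> objective f h u" for u
    using assms unfolding solutions_def is_arg_min_linorder by simp
  have "objective f h s < \<infinity>" using min[of x\<^sub>0] objective_eq[OF start] by (metis ereal_infty_less(1) ereal_infty_less_eq(1) PInfty_neq_ereal(1))
  then show s: "s \<in> edom h" by (rule objective_edom)
  have "opt_value f h = objective f h s"
    unfolding opt_value_def using min by (intro INF_eqI) auto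
  then show "opt_value f h = ereal (phi s)" using objective_eq[OF s] by simp
  show "phi s \<le> phi u" if "u \<in> edom h" using min[of u] objective_eq s that by simp
qed

text \<open>A serious iteration records a point that is no worse than the auxiliary point; if the recorded
  point is not an \<open>\<epsilon>\<close>-solution, then neither is the auxiliary one.\<close>

lemma aux_far:
  assumes "serious_index (Suc j)" "unsolved (Suc j)" "s \<in> solutions f h"
  shows "phi (aux_pt r (Suc j)) - phi s > \<epsilon>"
proof -
  have "counter r j < counter r (Suc j)" using run_serious(4)[OF assms(1)] by simp
  then have "\<not> objective f h (zhat r (counter r j)) - ereal (phi s) \<le> ereal \<epsilon>"
    using assms(2) solution(2)[OF assms(3)] unfolding unsolved_def eps_solution_def by simp
  moreover have "objective f h (zhat r (counter r j)) \<le> ereal (phi (aux_pt r (Suc j)))"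
    using run_serious(5)[OF assms(1)] objective_eq[OF aux_edom] by (auto simp: is_arg_min_linorder)
  ultimately show ?thesis by (cases "objective f h (zhat r (counter r j))") auto
qed

lemma center_descent:
  assumes "serious_index (Suc j)" "unsolved (Suc j)" "s \<in> solutions f h"
  shows "(1 + lam * \<mu>) * (norm (center r (Suc j) - s))\<^sup>2 + lam * \<epsilon> \<le> (norm (center r j - s))\<^sup>2"
proof -
  have "gap_succ j \<le> \<epsilon> / 2" using assms(1) serious_index_Suc by simp
  then show ?thesis
    using serious_descent[OF bundle_dom(1-3) iter_edom solution(1)[OF assms(3)] iter_minimizes _
        aux_far[OF assms]] run_serious(3)[OF assms(1)]
    unfolding gap_succ_def by simp
qed

text \<open>The descent of the centers, unrolled. Keeping the geometric sum gives the logarithmic bound,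
  and the first summand on the left shows that no center is farther from \<open>s\<close> than \<open>x\<^sub>0\<close>.\<close>

lemma energy:
  assumes "unsolved N" "s \<in> solutions f h"
  defines "q \<equiv> 1 + lam * \<mu>"
  shows "q ^ serious_count N * (norm (center r N - s))\<^sup>2 + lam * \<epsilon> * (\<Sum>i<serious_count N. q ^ i)
    \<le> (norm (x\<^sub>0 - s))\<^sup>2"
  using assms(1)
proof (induction N)
  case 0
  then show ?case by (simp add: run_init)
next
  case (Suc N)
  have IH: "q ^ serious_count N * (norm (center r N - s))\<^sup>2 + lam * \<epsilon> * (\<Sum>i<serious_count N. q ^ i)
    \<le> (norm (x\<^sub>0 - s))\<^sup>2" using Suc unsolved_mono[of "Suc N" N] by simp
  show ?case
  proof (cases "serious_index (Suc N)")
    case True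
    have "q \<ge> 0" unfolding q_def using lam_pos mu_nonneg by simp
    then have "q ^ serious_count N * (q * (norm (center r (Suc N) - s))\<^sup>2 + lam * \<epsilon>)
        \<le> q ^ serious_count N * (norm (center r N - s))\<^sup>2"
      unfolding q_def using center_descent[OF True Suc.prems assms(2)] by (intro mult_left_mono) auto
    then show ?thesis using IH True by (simp add: algebra_simps)
  next
    case False
    then show ?thesis using IH run_null(1)[OF False] by simp
  qed
qed

lemma q_ge_1: "1 + lam * \<mu> \<ge> 1"
  using lam_pos mu_nonneg by simp

lemma center_distance:
  assumes "unsolved N" "s \<in> solutions f h"
  shows "norm (center r N - s) \<le> norm (x\<^sub>0 - s)"
proof -
  let ?q = "1 + lam * \<mu>"
  have "1 * (norm (center r N - s))\<^sup>2 \<le> ?q ^ serious_count N * (norm (center r N - s))\<^sup>2"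
    using q_ge_1 by (intro mult_right_mono one_le_power) auto
  moreover have "0 \<le> lam * \<epsilon> * (\<Sum>i<serious_count N. ?q ^ i)"
    using q_ge_1 lam_pos eps_pos by (intro mult_nonneg_nonneg sum_nonneg) auto
  ultimately have "(norm (center r N - s))\<^sup>2 \<le> (norm (x\<^sub>0 - s))\<^sup>2" using energy[OF assms] by linarith
  then show ?thesis by (rule power2_le_imp_le) simp
qed

abbreviation d\<^sub>0 :: real where
  "d\<^sub>0 \<equiv> dist_solutions f h x\<^sub>0"

text \<open>Estimates that hold for every solution are transferred to the distance to the set of solutions by
  the rules \<open>le_dist_solutions\<close>, \<open>le_dist_solutions_power2\<close> and \<open>le_dist_solutions_affine\<close>, which avoid
  selecting a nearest solution.\<close>

lemma le_dist_solutions: "(\<And>s. s \<in> solutions f h \<Longrightarrow> b \<le> norm (x\<^sub>0 - s)) \<Longrightarrow> b \<le> d\<^sub>0"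
  using basic unfolding dist_solutions_def basic_assumptions_def by (intro cINF_greatest) auto

lemma dist_solutions_nonneg: "d\<^sub>0 \<ge> 0"
  by (rule le_dist_solutions) simp

lemma le_dist_solutions_power2:
  assumes "\<And>s. s \<in> solutions f h \<Longrightarrow> b \<le> (norm (x\<^sub>0 - s))\<^sup>2"
  shows "b \<le> d\<^sub>0\<^sup>2"
proof -
  have "sqrt b \<le> d\<^sub>0" using assms by (intro le_dist_solutions real_le_lsqrt) auto
  then show ?thesis using dist_solutions_nonneg sqrt_le_D by blast
qed

lemma le_dist_solutions_affine:
  assumes "\<And>s. s \<in> solutions f h \<Longrightarrow> b \<le> a + c * norm (x\<^sub>0 - s)" "c \<ge> 0"
  shows "b \<le> a + c * d\<^sub>0"
proof (cases "c = 0")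
  case True
  then show ?thesis using assms basic unfolding basic_assumptions_def by auto
next
  case False
  have "(b - a) / c \<le> d\<^sub>0"
    using assms False by (intro le_dist_solutions) (auto simp: divide_le_eq algebra_simps)
  then show ?thesis using assms(2) False by (simp add: divide_le_eq algebra_simps)
qed

text \<open>Every summand of the geometric sum is at least 1, which gives the first bound. Evaluating the sum
  gives \<open>q\<^sup>S \<le> \<mu> d\<^sub>0\<^sup>2 / \<epsilon> + 1\<close> with \<open>q = 1 + \<lambda> \<mu>\<close>, and \<open>ln q \<ge> 1 - 1 / q = \<lambda>' \<mu>\<close> turns this into the second
  one.\<close>

lemma serious_count_le:
  assumes "unsolved N"
  shows "serious_count N \<le> min (d\<^sub>0\<^sup>2 / (lam * \<epsilon>)) (log_term lam \<mu> d\<^sub>0 \<epsilon>)"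
proof -
  define q S where "q = 1 + lam * \<mu>" and "S = serious_count N"
  have q: "q \<ge> 1" unfolding q_def by (rule q_ge_1)
  have "lam * \<epsilon> * (\<Sum>i<S. q ^ i) \<le> (norm (x\<^sub>0 - s))\<^sup>2" if "s \<in> solutions f h" for s
  proof -
    have "0 \<le> q ^ S * (norm (center r N - s))\<^sup>2" using q by simp
    then show ?thesis using energy[OF assms that] unfolding q_def S_def by linarith
  qed
  then have geo: "lam * \<epsilon> * (\<Sum>i<S. q ^ i) \<le> d\<^sub>0\<^sup>2" by (rule le_dist_solutions_power2)
  have "(\<Sum>i<S. 1) \<le> (\<Sum>i<S. q ^ i)" using q by (intro sum_mono) simp
  then have "lam * \<epsilon> * S \<le> lam * \<epsilon> * (\<Sum>i<S. q ^ i)"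
    using lam_pos eps_pos by (intro mult_left_mono) auto
  then have 1: "S \<le> d\<^sub>0\<^sup>2 / (lam * \<epsilon>)"
    using order_trans[OF _ geo] lam_pos eps_pos by (simp add: pos_le_divide_eq mult.commute)
  have 2: "S \<le> log_term lam \<mu> d\<^sub>0 \<epsilon>"
  proof (cases "\<mu> = 0")
    case True
    then show ?thesis using 1 unfolding log_term_def by simp
  next
    case False
    then have mu: "\<mu> > 0" using mu_nonneg by simp
    have "lam * \<mu> * (\<Sum>i<S. q ^ i) = q ^ S - 1"
      using power_diff_1_eq[of q S] unfolding q_def by simp
    then have "\<epsilon> * (q ^ S - 1) = \<mu> * (lam * \<epsilon> * (\<Sum>i<S. q ^ i))" by (simp add: mult_ac)
    also have "\<dots> \<le> \<mu> * d\<^sub>0\<^sup>2" using geo mu by (intro mult_left_mono) auto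
    finally have "q ^ S \<le> \<mu> * d\<^sub>0\<^sup>2 / \<epsilon> + 1" using eps_pos by (simp add: field_simps)
    then have "ln (q ^ S) \<le> ln (\<mu> * d\<^sub>0\<^sup>2 / \<epsilon> + 1)" using q by (intro ln_mono) auto
    then have "S * ln q \<le> ln (\<mu> * d\<^sub>0\<^sup>2 / \<epsilon> + 1)" using q by (simp add: ln_realpow)
    moreover have "lam / q * \<mu> \<le> ln q"
    proof -
      have "ln (1 / q) \<le> 1 / q - 1" using q by (intro ln_le_minus_one) auto
      then have "1 - 1 / q \<le> ln q" using q by (simp add: ln_div)
      moreover have "lam / q * \<mu> = 1 - 1 / q" using q unfolding q_def by (simp add: field_simps)
      ultimately show ?thesis by simp
    qed
    ultimately have "S * (lam / q * \<mu>) \<le> ln (\<mu> * d\<^sub>0\<^sup>2 / \<epsilon> + 1)"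
      by (meson mult_left_mono of_nat_0_le_iff order_trans)
    moreover have "lam / q * \<mu> > 0" using q mu lam_pos by simp
    ultimately have "S \<le> ln (\<mu> * d\<^sub>0\<^sup>2 / \<epsilon> + 1) / (lam / q * \<mu>)"
      by (simp only: pos_le_divide_eq)
    then show ?thesis using mu unfolding log_term_def q_def by (simp add: mult.commute)
  qed
  show ?thesis using 1 2 unfolding S_def by simp
qed


section \<open>The length of a cycle\<close>

lemma serious_center: "serious_index l \<Longrightarrow> center r l = iter r l"
  using run_serious(3) run_init by (cases l) auto

lemma null_run_length:
  fixes p :: nat
  assumes "p > 0" "\<And>j. \<lbrakk>l < j; j \<le> l + p\<rbrakk> \<Longrightarrow> \<not> serious_index j"
  shows "p * (\<epsilon> / 2) \<le> 8 * lam_eff * Mf\<^sup>2 + gap_succ l"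
proof -
  have large: "gap_succ (l + i) > \<epsilon> / 2" if "i < p" for i
    using assms(2)[of "Suc (l + i)"] that serious_index_Suc[of "l + i"] by auto
  have "(gap_succ (l + Suc i))\<^sup>2 \<le> 8 * lam_eff * Mf\<^sup>2 * (gap_succ (l + i) - gap_succ (l + Suc i))"
    if "Suc i < p" for i
    using gap_succ_null_step[of "l + i"] assms(2)[of "Suc (l + i)"] large[OF that] eps_pos that by auto
  then show ?thesis
    using sublinear_decrease_length[of "8 * lam_eff * Mf\<^sup>2" "\<epsilon> / 2" p "\<lambda>i. gap_succ (l + i)"]
      large eps_pos lam_eff_pos assms(1) by auto
qed

text \<open>A real number although \<open>Mh\<close> may be infinite: the minimum of \<open>\<lambda> (M\<^sub>f + M\<^sub>h)\<close> and \<open>\<lambda>' M\<^sub>f + d\<^sub>0\<close>.\<close>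

definition step_bound :: real where
  "step_bound = (if Mh = \<infinity> then lam_eff * Mf + d\<^sub>0
     else min (lam * (Mf + real_of_ereal Mh)) (lam_eff * Mf + d\<^sub>0))"

lemma step_bound_nonneg: "step_bound \<ge> 0"
  unfolding step_bound_def using Mf_nonneg Mh_nonneg lam_pos lam_eff_pos dist_solutions_nonneg
  by (auto simp: real_of_ereal_pos)

text \<open>With \<open>n\<close> the length of the first step of the cycle, \<open>p\<close> null steps satisfy
  \<open>p \<epsilon> \<le> M\<^sub>f (16 \<lambda>' M\<^sub>f + 4 n)\<close>, and the two estimates of \<open>n\<close> are inserted. The constant 32 is the
  largest one that occurs, from \<open>n \<le> 4 \<lambda>' M\<^sub>f + 2 \<parallel>c - s\<parallel>\<close>.\<close>

lemma null_run_length_uniform: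
  fixes p :: nat
  assumes "serious_index l" "unsolved l" "\<And>j. \<lbrakk>l < j; j \<le> l + p\<rbrakk> \<Longrightarrow> \<not> serious_index j"
  shows "p \<le> 32 * Mf * step_bound / \<epsilon>"
proof (cases "p = 0")
  case True
  then show ?thesis using Mf_nonneg step_bound_nonneg eps_pos by simp
next
  case False
  define n where "n = norm (iter r (Suc l) - iter r l)"
  have "p * (\<epsilon> / 2) \<le> 8 * lam_eff * Mf\<^sup>2 + gap_succ l"
    using null_run_length[of p l] assms(3) False by simp
  also have "\<dots> \<le> 8 * lam_eff * Mf\<^sup>2 + 2 * Mf * n" unfolding n_def using gap_succ_le[of l] by simp
  finally have p: "p * \<epsilon> \<le> Mf * (16 * lam_eff * Mf + 4 * n)"
    by (simp add: power2_eq_square algebra_simps)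
  note c = serious_center[OF assms(1)]
  have "p * \<epsilon> \<le> 32 * lam_eff * Mf * Mf + 8 * Mf * norm (x\<^sub>0 - s)" if s: "s \<in> solutions f h" for s
  proof -
    have "n \<le> 4 * lam_eff * Mf + 2 * norm (iter r l - s)"
      unfolding n_def
      using step_length_minimizer[OF bundle_dom(1,3) iter_edom bundle_dom(4) solution(1)[OF s]
          iter_minimizes[of _ l, unfolded c] solution(3)[OF s iter_edom]] by simp
    moreover have "norm (iter r l - s) \<le> norm (x\<^sub>0 - s)"
      using center_distance[OF assms(2) s] c by simp
    ultimately have "16 * lam_eff * Mf + 4 * n \<le> 32 * lam_eff * Mf + 8 * norm (x\<^sub>0 - s)" by argo
    then have "Mf * (16 * lam_eff * Mf + 4 * n) \<le> Mf * (32 * lam_eff * Mf + 8 * norm (x\<^sub>0 - s))"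
      using Mf_nonneg by (intro mult_left_mono)
    then show ?thesis using p by (simp add: algebra_simps)
  qed
  then have "p * \<epsilon> \<le> 32 * lam_eff * Mf * Mf + 8 * Mf * d\<^sub>0"
    using Mf_nonneg by (intro le_dist_solutions_affine) auto
  also have "8 * Mf * d\<^sub>0 \<le> 32 * Mf * d\<^sub>0"
    using Mf_nonneg dist_solutions_nonneg by (intro mult_right_mono) auto
  finally have 1: "p * \<epsilon> \<le> 32 * Mf * (lam_eff * Mf + d\<^sub>0)" by (simp add: algebra_simps)
  have 2: "p * \<epsilon> \<le> 32 * Mf * (lam * (Mf + real_of_ereal Mh))" if fin: "Mh \<noteq> \<infinity>"
  proof -
    define mh where "mh = real_of_ereal Mh"
    have Mh: "Mh = ereal mh" "mh \<ge> 0" unfolding mh_def using fin Mh_nonneg by (cases Mh; simp)+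
    have "\<bar>h (iter r l) - h (iter r (Suc l))\<bar> \<le> Mh * ereal (norm (iter r l - iter r (Suc l)))"
      using basic iter_edom unfolding basic_assumptions_def by blast
    then have "real_of_ereal (h (iter r l)) - real_of_ereal (h (iter r (Suc l)))
        \<le> mh * norm (iter r l - iter r (Suc l))"
      unfolding Mh(1) using h_finite[OF iter_edom[of l]] h_finite[OF iter_edom[of "Suc l"]]
      by (cases "h (iter r l)"; cases "h (iter r (Suc l))") auto
    then have "n \<le> lam * (Mf + mh)"
      unfolding n_def
      using step_length_Lipschitz[OF bundle_dom(1-3) iter_edom iter_edom
          iter_minimizes[of _ l, unfolded c]] Mh(2) by blast
    moreover have "lam_eff * Mf \<le> lam * (Mf + mh)"
      using lam_eff_le lam_pos Mf_nonneg Mh(2) by (intro mult_mono) auto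
    moreover have "0 \<le> lam * (Mf + mh)" using lam_pos Mf_nonneg Mh(2) by simp
    ultimately have "16 * lam_eff * Mf + 4 * n \<le> 32 * (lam * (Mf + mh))" by linarith
    then have "Mf * (16 * lam_eff * Mf + 4 * n) \<le> Mf * (32 * (lam * (Mf + mh)))"
      using Mf_nonneg by (intro mult_left_mono)
    then show ?thesis using p unfolding mh_def by (simp add: algebra_simps)
  qed
  have "p * \<epsilon> \<le> 32 * Mf * step_bound"
    unfolding step_bound_def using 1 2 by (auto simp: min_def)
  then show ?thesis using eps_pos by (simp add: pos_le_divide_eq)
qed

definition cycle_bound :: real where
  "cycle_bound = 32 * Mf * step_bound / \<epsilon> + 1"

lemma next_serious:
  assumes "serious_index l" "unsolved l"
  shows "\<exists>l'>l. serious_index l' \<and> (\<forall>j. l < j \<and> j < l' \<longrightarrow> \<not> serious_index j)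
    \<and> real l' - real l \<le> cycle_bound"
proof -
  have "\<exists>l'>l. serious_index l'"
  proof (rule ccontr)
    assume "\<not> (\<exists>l'>l. serious_index l')"
    then have "real p \<le> 32 * Mf * step_bound / \<epsilon>" for p
      using null_run_length_uniform[OF assms, of p] by auto
    then show False using reals_Archimedean2 not_less by metis
  qed
  then obtain l' where l': "l' > l" "serious_index l'" and least: "\<And>j. \<lbrakk>l < j; j < l'\<rbrakk> \<Longrightarrow> \<not> serious_index j"
    using exists_least_iff[of "\<lambda>j. j > l \<and> serious_index j"] by auto
  have "real (l' - l - 1) \<le> 32 * Mf * step_bound / \<epsilon>"
    using l'(1) least by (intro null_run_length_uniform[OF assms]) auto
  then have "real l' - real l \<le> cycle_bound"
    unfolding cycle_bound_def using l'(1) by (simp add: of_nat_diff)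
  then show ?thesis using l' least by blast
qed

text \<open>Up to an index \<open>N\<close> there are \<open>serious_count N\<close> complete cycles and the beginning of another one,
  which ends only after \<open>N\<close>; the latter accounts for both summands 1.\<close>

lemma unsolved_length:
  assumes "unsolved N"
  shows "real N + 1 \<le> cycle_bound * (real (serious_count N) + 1)"
  using assms
proof (induction N rule: less_induct)
  case (less N)
  define l where "l = (GREATEST l. l \<le> N \<and> serious_index l)"
  have "0 \<le> N \<and> serious_index 0" unfolding serious_def by simp
  then have l: "l \<le> N" "serious_index l" and greatest: "\<And>j. \<lbrakk>j \<le> N; serious_index j\<rbrakk> \<Longrightarrow> j \<le> l"
    unfolding l_def using GreatestI_nat[of "\<lambda>l. l \<le> N \<and> serious_index l" 0 N]
      Greatest_le_nat[of "\<lambda>l. l \<le> N \<and> serious_index l" _ N] by auto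
  have "unsolved l" using less.prems l(1) unsolved_mono by blast
  then obtain l' where l': "l' > l" "serious_index l'" "real l' - real l \<le> cycle_bound"
    using next_serious[OF l(2)] by blast
  then have "N < l'" using greatest[of l'] by force
  then have tail: "real N + 1 - real l \<le> cycle_bound" using l'(3) by simp
  have "real l \<le> cycle_bound * real (serious_count N)"
  proof (cases l)
    case 0
    then show ?thesis unfolding cycle_bound_def
      using Mf_nonneg step_bound_nonneg eps_pos by simp
  next
    case (Suc k)
    have "serious_count l \<le> serious_count N"
      unfolding serious_count_def using l(1) by (intro card_mono) auto
    then have "cycle_bound * real (serious_count l) \<le> cycle_bound * real (serious_count N)"
      unfolding cycle_bound_def
      using Mf_nonneg step_bound_nonneg eps_pos by (intro mult_left_mono) auto
    moreover have "real k + 1 \<le> cycle_bound * (real (serious_count k) + 1)"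
      using less.IH[of k] unsolved_mono[OF less.prems, of k] l(1) Suc by simp
    ultimately show ?thesis using Suc l(2) by (simp add: add.commute)
  qed
  then show ?case using tail by (simp add: distrib_left)
qed


section \<open>The complexity bound\<close>

abbreviation serious_bound :: real where
  "serious_bound \<equiv> min (d\<^sub>0\<^sup>2 / (lam * \<epsilon>)) (log_term lam \<mu> d\<^sub>0 \<epsilon>) + 1"

lemma serious_bound_nonneg: "0 \<le> serious_bound"
proof -
  have "0 \<le> log_term lam \<mu> d\<^sub>0 \<epsilon>" unfolding log_term_def
    using lam_pos eps_pos mu_nonneg q_ge_1 by (auto intro!: mult_nonneg_nonneg divide_nonneg_nonneg)
  moreover have "0 \<le> d\<^sub>0\<^sup>2 / (lam * \<epsilon>)" using lam_pos eps_pos by simp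
  ultimately show ?thesis by simp
qed

text \<open>While no \<open>\<epsilon>\<close>-solution has been found, the number of iterations is bounded, so one is found; the
  bounds at the first such iteration follow from those one iteration earlier, to which at most one
  serious iteration is added.\<close>

lemma solved:
  "\<exists>N. performed_until_solved f h \<epsilon> r N \<and> serious_count N \<le> serious_bound
     \<and> real N \<le> cycle_bound * serious_bound"
proof -
  have c1: "cycle_bound \<ge> 0" unfolding cycle_bound_def
      using Mf_nonneg step_bound_nonneg eps_pos by simp
  have length: "real N + 1 \<le> cycle_bound * serious_bound" if "unsolved N" for N
  proof -
    have "cycle_bound * (real (serious_count N) + 1) \<le> cycle_bound * serious_bound"
      using serious_count_le[OF that] c1 by (intro mult_left_mono) auto
    then show ?thesis using unsolved_length[OF that] by linarith
  qed
  have "\<exists>N. \<not> unsolved N"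
  proof (rule ccontr)
    assume "\<nexists>N. \<not> unsolved N"
    then have "real N \<le> cycle_bound * serious_bound" for N using length[of N] by simp
    then show False using reals_Archimedean2 not_less by metis
  qed
  then obtain N where N: "\<not> unsolved N" "\<And>j. j < N \<Longrightarrow> unsolved j"
    using exists_least_iff[of "\<lambda>N. \<not> unsolved N"] by auto
  have per: "performed_until_solved f h \<epsilon> r N"
    using N unfolding performed_until_solved_def unsolved_def by auto
  show ?thesis
  proof (cases N)
    case 0
    then show ?thesis using per c1 serious_bound_nonneg by (intro exI[of _ N]) simp
  next
    case (Suc k)
    then have k: "unsolved k" using N(2) by simp
    have "serious_count N \<le> serious_count k + 1" using Suc by simp
    then have "serious_count N \<le> serious_bound" using serious_count_le[OF k] by linarith
    moreover have "real N \<le> cycle_bound * serious_bound" using length[OF k] Suc by simp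
    ultimately show ?thesis using per by blast
  qed
qed

lemma ereal_step_bound:
  "ereal step_bound = min (ereal lam * (ereal Mf + Mh)) (ereal (lam_eff * Mf + d\<^sub>0))"
  unfolding step_bound_def using Mh_nonneg lam_pos by (cases Mh) (auto simp: min_def)

lemma constant_ge: "32 \<le> 2 * 16 powr (4 / 3 :: real)"
  using powr_mono[of 1 "4 / 3" "16 :: real"] by simp

text \<open>For infinite \<open>Mh\<close> the first term of the minimum is infinite, unless \<open>Mf = 0\<close>; then it is
  \<open>\<infinity> * 0 = 0\<close>, and the inequality still holds since the left-hand side has the factor \<open>Mf\<close>.\<close>

lemma cycle_bound_le:
  "ereal cycle_bound \<le> min (ereal (2 * 16 powr (4/3) * lam) * (ereal Mf + Mh) * ereal Mf)
     (ereal (2 * 16 powr (4/3) * lam_eff * Mf\<^sup>2 + 40 * sqrt 2 * Mf * d\<^sub>0)) / ereal \<epsilon> + 1"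
proof -
  define K :: real where "K = 2 * 16 powr (4 / 3)"
  have K: "32 \<le> K" unfolding K_def by (rule constant_ge)
  have "32 * Mf * step_bound \<le> 32 * Mf * (lam_eff * Mf + d\<^sub>0)"
    unfolding step_bound_def using Mf_nonneg by (intro mult_left_mono) auto
  also have "\<dots> = 32 * (lam_eff * Mf\<^sup>2) + 32 * (Mf * d\<^sub>0)" by (simp add: power2_eq_square algebra_simps)
  also have "\<dots> \<le> K * (lam_eff * Mf\<^sup>2) + 40 * sqrt 2 * (Mf * d\<^sub>0)"
  proof (intro add_mono mult_right_mono K)
    have "1 \<le> sqrt 2" by simp
    then show "32 \<le> 40 * sqrt 2" by linarith
  qed (use lam_eff_pos Mf_nonneg dist_solutions_nonneg in auto)
  finally have 1: "ereal (32 * Mf * step_bound) \<le> ereal (K * lam_eff * Mf\<^sup>2 + 40 * sqrt 2 * Mf * d\<^sub>0)"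
    by (simp add: mult.assoc)
  have 2: "ereal (32 * Mf * step_bound) \<le> ereal (K * lam) * (ereal Mf + Mh) * ereal Mf"
  proof (cases Mh)
    case (real mh)
    have "32 * (Mf * step_bound) \<le> K * (Mf * (lam * (Mf + mh)))"
      using K Mf_nonneg Mh_nonneg lam_pos step_bound_nonneg real unfolding step_bound_def
      by (intro mult_mono) auto
    then show ?thesis using real by (simp add: mult_ac)
  next
    case PInf
    then show ?thesis using K lam_pos Mf_nonneg by (cases "Mf = 0") auto
  qed (use Mh_nonneg in auto)
  have "ereal cycle_bound = ereal (32 * Mf * step_bound) / ereal \<epsilon> + 1"
    unfolding cycle_bound_def using eps_pos by (simp add: one_ereal_def)
  also have "\<dots> \<le> min (ereal (K * lam) * (ereal Mf + Mh) * ereal Mf)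
      (ereal (K * lam_eff * Mf\<^sup>2 + 40 * sqrt 2 * Mf * d\<^sub>0)) / ereal \<epsilon> + 1"
    using 1 2 eps_pos by (intro add_right_mono ereal_divide_right_mono) auto
  finally show ?thesis unfolding K_def .
qed

lemma total_bound_le:
  "ereal (cycle_bound * serious_bound)
    \<le> (ereal (2 * 16 powr (4/3) * Mf) * min (ereal lam * (ereal Mf + Mh)) (ereal (lam_eff * Mf + d\<^sub>0))
         / ereal \<epsilon> + 1) * ereal serious_bound"
proof -
  define K :: real where "K = 2 * 16 powr (4 / 3)"
  have K: "32 \<le> K" unfolding K_def by (rule constant_ge)
  have "32 * Mf * step_bound \<le> K * Mf * step_bound"
    using K Mf_nonneg step_bound_nonneg by (intro mult_right_mono) auto
  then have "32 * Mf * step_bound / \<epsilon> \<le> K * Mf * step_bound / \<epsilon>"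
    using eps_pos by (intro divide_right_mono) auto
  then have "cycle_bound * serious_bound \<le> (K * Mf * step_bound / \<epsilon> + 1) * serious_bound"
    unfolding cycle_bound_def using serious_bound_nonneg by (intro mult_right_mono) auto
  moreover have "ereal ((K * Mf * step_bound / \<epsilon> + 1) * serious_bound)
      = (ereal (K * Mf) * ereal step_bound / ereal \<epsilon> + 1) * ereal serious_bound"
    using eps_pos by (simp add: one_ereal_def)
  ultimately show ?thesis
    unfolding ereal_step_bound[symmetric] K_def[symmetric] by (metis ereal_less_eq(3))
qed

end

theorem theorem3p1:
  fixes f h :: "real ^ 'n \<Rightarrow> ereal" and f' :: "real ^ 'n \<Rightarrow> real ^ 'n"
    and M\<^sub>f \<mu> lam \<epsilon> lamt d\<^sub>0 :: real and M\<^sub>h M :: ereal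
    and x\<^sub>0 :: "real ^ 'n" and r :: "(real ^ 'n) rpb_run"
  assumes "M\<^sub>f \<ge> 0" and "M\<^sub>h \<ge> 0" and "\<mu> \<ge> 0"
    and "basic_assumptions f f' h M\<^sub>f M\<^sub>h \<mu>"
    and "x\<^sub>0 \<in> edom h" and "lam > 0" and "\<epsilon> > 0"
    and "rpb f f' h x\<^sub>0 lam (\<epsilon> / 2) r"
  defines "M \<equiv> ereal M\<^sub>f + M\<^sub>h"
    and "lamt \<equiv> lam / (1 + lam * \<mu>)"
    and "d\<^sub>0 \<equiv> dist_solutions f h x\<^sub>0"
  shows
    "(\<exists>N. performed_until_solved f h \<epsilon> r N \<and>
          real (card {j \<in> {1..N}. serious f f' h lam (\<epsilon> / 2) r j})
            \<le> min (d\<^sub>0\<^sup>2 / (lam * \<epsilon>)) (log_term lam \<mu> d\<^sub>0 \<epsilon>) + 1) \<and>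
     (\<forall>l\<^sub>0. serious f f' h lam (\<epsilon> / 2) r l\<^sub>0 \<and>
           (\<forall>k<counter r l\<^sub>0. objective f h (zhat r k) - opt_value f h > ereal \<epsilon>) \<longrightarrow>
         (\<exists>l\<^sub>1>l\<^sub>0. serious f f' h lam (\<epsilon> / 2) r l\<^sub>1 \<and>
            (\<forall>j. l\<^sub>0 < j \<and> j < l\<^sub>1 \<longrightarrow> \<not> serious f f' h lam (\<epsilon> / 2) r j) \<and>
            ereal (real l\<^sub>1 - real l\<^sub>0)
              \<le> min (ereal (2 * 16 powr (4/3) * lam) * M * ereal M\<^sub>f)
                     (ereal (2 * 16 powr (4/3) * lamt * M\<^sub>f\<^sup>2 + 40 * sqrt 2 * M\<^sub>f * d\<^sub>0))
                  / ereal \<epsilon> + 1)) \<and>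
     (\<exists>N. performed_until_solved f h \<epsilon> r N \<and>
         ereal (real N)
           \<le> (ereal (2 * 16 powr (4/3) * M\<^sub>f) * min (ereal lam * M) (ereal (lamt * M\<^sub>f + d\<^sub>0))
                  / ereal \<epsilon> + 1)
              * ereal (min (d\<^sub>0\<^sup>2 / (lam * \<epsilon>)) (log_term lam \<mu> d\<^sub>0 \<epsilon>) + 1))"
proof -
  interpret rpb_execution f h f' M\<^sub>f M\<^sub>h \<mu> x\<^sub>0 lam \<epsilon> r
    using assms(1-8) by unfold_locales
  have lamt: "lamt = lam_eff"
    unfolding lamt_def lam_eff_def ..
  show ?thesis
    unfolding M_def lamt d\<^sub>0_def
  proof (intro conjI allI impI)
    show "\<exists>N. performed_until_solved f h \<epsilon> r N \<and>
        real (card {j \<in> {1..N}. serious f f' h lam (\<epsilon> / 2) r j}) \<le> serious_bound"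
      using solved unfolding serious_count_def by blast
  next
    fix l\<^sub>0
    assume "serious_index l\<^sub>0 \<and> (\<forall>k<counter r l\<^sub>0. ereal \<epsilon> < objective f h (zhat r k) - opt_value f h)"
    then have "serious_index l\<^sub>0" "unsolved l\<^sub>0"
      unfolding unsolved_def eps_solution_def by (auto simp: not_le)
    then obtain l\<^sub>1 where l\<^sub>1: "l\<^sub>1 > l\<^sub>0" "serious_index l\<^sub>1" "\<forall>j. l\<^sub>0 < j \<and> j < l\<^sub>1 \<longrightarrow> \<not> serious_index j"
      "real l\<^sub>1 - real l\<^sub>0 \<le> cycle_bound"
      using next_serious by blast
    have "ereal (real l\<^sub>1 - real l\<^sub>0) \<le> ereal cycle_bound" using l\<^sub>1(4) by simp
    note this[THEN order_trans, OF cycle_bound_le]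
    then show "\<exists>l\<^sub>1>l\<^sub>0. serious_index l\<^sub>1 \<and> (\<forall>j. l\<^sub>0 < j \<and> j < l\<^sub>1 \<longrightarrow> \<not> serious_index j) \<and>
        ereal (real l\<^sub>1 - real l\<^sub>0)
          \<le> min (ereal (2 * 16 powr (4/3) * lam) * (ereal M\<^sub>f + M\<^sub>h) * ereal M\<^sub>f)
              (ereal (2 * 16 powr (4/3) * lam_eff * M\<^sub>f\<^sup>2 + 40 * sqrt 2 * M\<^sub>f * dist_solutions f h x\<^sub>0)) / ereal \<epsilon> + 1"
      using l\<^sub>1(1-3) by blast
  next
    obtain N where "performed_until_solved f h \<epsilon> r N" "ereal (real N) \<le> ereal (cycle_bound * serious_bound)"
      using solved by auto
    then show "\<exists>N. performed_until_solved f h \<epsilon> r N \<and> ereal (real N)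
        \<le> (ereal (2 * 16 powr (4/3) * M\<^sub>f) * min (ereal lam * (ereal M\<^sub>f + M\<^sub>h)) (ereal (lam_eff * M\<^sub>f + dist_solutions f h x\<^sub>0))
             / ereal \<epsilon> + 1) * ereal serious_bound"
      using total_bound_le order_trans by blast
  qed
qed

end
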